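(* Let $V$ be a simple, self-dual vertex operator algebra of CFT-type with central charge $C$ and genus two partition function $Z_V^{(2)}(q_1,q_2,\epsilon)$. Then $$\lim_{q_2\rightarrow0}q_2^{C/24}Z_V^{(2)}(q_1,q_2,\epsilon)=\sum_{n\ge0}\epsilon^nZ_V^{(1)}(\widetilde\lambda^{[n]},q_1),$$ where $\widetilde\lambda^{[n]}\in V_{[n]}$ is the square bracket weight $n$ component of $\widetilde\lambda=T\,T^\dagger\mathbf 1$, as defined in the context.
   Context: **VOA conventions.** $(V,Y,\mathbf 1,\omega)$ is a vertex operator algebra over $\mathbb C$, $V=\bigoplus_nV_n$ with $\dim V_n<\infty$, $Y(u,z)=\sum_nu_nz^{-n-1}$, $Y(\omega,z)=\sum_nL_nz^{-n-2}$, Virasoro central charge $C$, $L_0u=nu$ for $u\in V_n$. CFT-type means $V_0=\mathbb C\mathbf 1$ (hence $V_n=0$ for $n<0$); self-dual means $V\cong V'$ as $V$-modules. For homogeneous $u\in V_k$ set $o(u)=u_{k-1}$, extended linearly to all of $V$. **Square bracket VOA.** $Y[v,z]=\sum_nv[n]z^{-n-1}=Y(e^{zL_0}v,e^z-1)$, conformal vector $\widetilde\omega=\omega-\frac C{24}\mathbf 1$, $Y[\widetilde\omega,z]=\sum_nL[n]z^{-n-2}$, $V_{[n]}=\{u:L[0]u=nu\}$. $\langle\,,\rangle_{[\,]}$ is the unique non-degenerate symmetric bilinear form with $\langle\mathbf 1,\mathbf 1\rangle_{[\,]}=1$ satisfying $\langle Y[u,z]a,b\rangle_{[\,]}=\langle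 a,Y[e^{zL[1]}(-z^{-2})^{L[0]}u,z^{-1}]b\rangle_{[\,]}$. **The vectors $\widetilde\lambda^{[n]}$.** Rational numbers $\alpha_i$ ($i\ge1$) are defined by $e^z-1=\exp\left(\sum_{i\ge1}\alpha_iz^{i+1}\partial_z\right)z$ (so $\alpha_1=\frac12,\alpha_2=-\frac1{12},\alpha_3=\frac1{48},\dots$; put $\alpha_0=0$). Let $T=\exp\left(\sum_{i\ge0}\alpha_iL_i\right)$ and $T^\dagger=\exp\left(\sum_{i\ge0}\alpha_iL_{-i}\right)$. Write $\lambda=T^\dagger\mathbf 1=\sum_{n\ge0}\lambda^{(n)}$ with $\lambda^{(n)}\in V_n$ (a sum in the completion of $V$), and $\widetilde\lambda^{[n]}=T\lambda^{(n)}\in V_{[n]}$, $\widetilde\lambda=T\lambda=\sum_{n\ge0}\widetilde\lambda^{[n]}$. **Partition and 1-point functions.** $Z_V^{(1)}(u,q)=\mathrm{Tr}_V(o(u)q^{L_0-C/24})$ and $$Z_V^{(2)}(q_1,q_2,\epsilon)=\sum_{n\ge0}\epsilon^n\sum_{u\in V_{[n]}}Z_V^{(1)}(u,q_1)Z_V^{(1)}(\overline u,q_2),$$ where $u$ ranges over any basis of $V_{[n]}$ and $\overline u$ is the dual basis with respect to $\langle\,,\rangle_{[\,]}$. Both sides of the identity are regarded as power series in $\epsilon$, with the limit $q_2\to0$ taken coefficientwise (each coefficient of $q_2^{C/24}Z_V^{(2)}$ is a power series in $q_2$, and the limit is its constant term). *)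

theory Defs
  imports "HOL-Computational_Algebra.Formal_Laurent_Series" "HOL-Library.Groups_Big_Fun" Complex_Main
begin

section \<open>Vertex operator algebras\<close>

text \<open>
  The underlying space is the whole type \<open>'a\<close>, with complex scalar multiplication
  \<open>vscale V\<close>.  \<open>vmode V u n\<close> is the mode \<open>u\<^sub>n\<close>, i.e. \<open>Y(u,z) = (\<Sum>n. u\<^sub>n z^(-n-1))\<close>.
  Sums over an infinite index set are written with \<^const>\<open>Sum_any\<close>; in each case at most finitely many terms are nonzero for the structures considered.
\<close>

record 'a voa =
  vscale :: "complex \<Rightarrow> 'a \<Rightarrow> 'a"
  vmode :: "'a \<Rightarrow> int \<Rightarrow> 'a \<Rightarrow> 'a"
  vac :: 'a
  omega :: 'a
  ccharge :: complex

definition Lm :: "'a voa \<Rightarrow> int \<Rightarrow> 'a \<Rightarrow> 'a" where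
  "Lm V n = vmode V (omega V) (n + 1)"

definition eigsp :: "'a voa \<Rightarrow> complex \<Rightarrow> 'a set" where
  "eigsp V c = {u. Lm V 0 u = vscale V c u}"

definition wsp :: "'a voa \<Rightarrow> int \<Rightarrow> 'a set" where
  "wsp V n = eigsp V (of_int n)"

definition voa :: "'a::ab_group_add voa \<Rightarrow> bool" where
  "voa V \<longleftrightarrow>
     vector_space (vscale V) \<and>
     (\<forall>u n. Vector_Spaces.linear (vscale V) (vscale V) (\<lambda>v. vmode V u n v)) \<and>
     (\<forall>v n. Vector_Spaces.linear (vscale V) (vscale V) (\<lambda>u. vmode V u n v)) \<and>
     \<comment> \<open>lower truncation\<close>
     (\<forall>u v. \<exists>N. \<forall>n\<ge>N. vmode V u n v = 0) \<and>
     \<comment> \<open>vacuum and creation\<close>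
     (\<forall>n v. vmode V (vac V) n v = (if n = -1 then v else 0)) \<and>
     (\<forall>u. vmode V u (-1) (vac V) = u \<and> (\<forall>n\<ge>0. vmode V u n (vac V) = 0)) \<and>
     \<comment> \<open>Jacobi identity in component form (Borcherds identity)\<close>
     (\<forall>u v w l m n.
        Sum_any (\<lambda>i. vscale V (of_int m gchoose i)
                    (vmode V (vmode V u (l + int i) v) (m + n - int i) w)) =
        Sum_any (\<lambda>i. vscale V ((-1) ^ i * (of_int l gchoose i))
                    (vmode V u (l + m - int i) (vmode V v (n + int i) w)
                     - vscale V ((-1) powi l)
                         (vmode V v (l + n - int i) (vmode V u (m + int i) w))))) \<and>
     \<comment> \<open>Virasoro relations\<close>
     (\<forall>m n w. Lm V m (Lm V n w) - Lm V n (Lm V m w) =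
        vscale V (of_int (m - n)) (Lm V (m + n) w)
        + vscale V (if m + n = 0 then of_int (m ^ 3 - m) / 12 * ccharge V else 0) w) \<and>
     \<comment> \<open>\<open>Y(L\<^sub>-\<^sub>1 u, z) = \<partial>\<^sub>z Y(u, z)\<close>\<close>
     (\<forall>u n v. vmode V (Lm V (-1) u) n v = vscale V (- of_int n) (vmode V u (n - 1) v)) \<and>
     \<comment> \<open>grading; the sum of the \<open>wsp V n\<close> is direct, these being eigenspaces\<close>
     module.span (vscale V) (\<Union>n. wsp V n) = UNIV \<and>
     (\<forall>n. \<exists>S. finite S \<and> wsp V n \<subseteq> module.span (vscale V) S) \<and>
     (\<exists>N. \<forall>n<N. wsp V n = {0})"

text \<open>The weight \<open>n\<close> component of \<open>u\<close>, and linear extension of an expression \<open>f k w\<close>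
  which is given for \<open>w\<close> homogeneous of weight \<open>k\<close>.\<close>

definition wpart :: "'a::ab_group_add voa \<Rightarrow> int \<Rightarrow> 'a \<Rightarrow> 'a" where
  "wpart V n u =
     (THE f. finite {k. f k \<noteq> 0} \<and> (\<forall>k. f k \<in> wsp V k) \<and> Sum_any f = u) n"

definition homog_ext ::
    "'a::ab_group_add voa \<Rightarrow> (int \<Rightarrow> 'a \<Rightarrow> 'b::comm_monoid_add) \<Rightarrow> 'a \<Rightarrow> 'b" where
  "homog_ext V f u = Sum_any (\<lambda>k. f k (wpart V k u))"

definition simple_voa :: "'a::ab_group_add voa \<Rightarrow> bool" where
  "simple_voa V \<longleftrightarrow> (\<exists>v::'a. v \<noteq> 0) \<and>
     (\<forall>I. module.subspace (vscale V) I \<and> (\<forall>u n. \<forall>v\<in>I. vmode V u n v \<in> I)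
          \<longrightarrow> I = {0} \<or> I = UNIV)"

definition cft_type :: "'a::ab_group_add voa \<Rightarrow> bool" where
  "cft_type V \<longleftrightarrow> wsp V 0 = module.span (vscale V) {vac V}"

text \<open>The coefficient of \<open>z^(-n-1)\<close> in \<open>Y(e^(z L\<^sub>1) (-z^(-2))^(L\<^sub>0) u, z^(-1)) b\<close>.  For \<open>u\<close> of
  weight \<open>k\<close> this series is \<open>(\<Sum>i m. (-1)^k / i! * (L\<^sub>1^i u)\<^sub>m b * z^(i - 2k + m + 1))\<close>.\<close>

definition adj_mode :: "'a::ab_group_add voa \<Rightarrow> 'a \<Rightarrow> int \<Rightarrow> 'a \<Rightarrow> 'a" where
  "adj_mode V u n b =
     homog_ext V (\<lambda>k w. Sum_any (\<lambda>i. vscale V ((-1) powi k / fact i)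
        (vmode V ((Lm V 1 ^^ i) w) (2 * k - n - int i - 2) b))) u"

text \<open>The contragredient module \<open>V'\<close>: the graded dual space with its modes.\<close>

definition graded_dual :: "'a::ab_group_add voa \<Rightarrow> ('a \<Rightarrow> complex) set" where
  "graded_dual V = {f. Vector_Spaces.linear (vscale V) (*) f \<and>
                       finite {n. \<exists>v\<in>wsp V n. f v \<noteq> 0}}"

definition dual_mode ::
    "'a::ab_group_add voa \<Rightarrow> 'a \<Rightarrow> int \<Rightarrow> ('a \<Rightarrow> complex) \<Rightarrow> ('a \<Rightarrow> complex)" where
  "dual_mode V u n f = (\<lambda>v. f (adj_mode V u n v))"

definition self_dual :: "'a::ab_group_add voa \<Rightarrow> bool" where
  "self_dual V \<longleftrightarrow>
     (\<exists>\<phi>. (\<forall>w. Vector_Spaces.linear (vscale V) (*) (\<lambda>v. \<phi> v w)) \<and>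
          bij_betw \<phi> UNIV (graded_dual V) \<and>
          (\<forall>u n v. \<phi> (vmode V u n v) = dual_mode V u n (\<phi> v)))"


section \<open>The square bracket vertex operator algebra\<close>

text \<open>\<open>Y[v,z] = Y(e^(z L\<^sub>0) v, e^z - 1)\<close>; for \<open>v\<close> of weight \<open>k\<close> this is
  \<open>(\<Sum>m. e^(kz) (e^z - 1)^(-m-1) v\<^sub>m)\<close>, expanded as Laurent series in \<open>z\<close>.\<close>

definition sq_coeff :: "int \<Rightarrow> int \<Rightarrow> int \<Rightarrow> complex" where
  "sq_coeff k m n =
     fls_nth (fps_to_fls (fps_exp (of_int k)) * fps_to_fls (fps_exp 1 - 1) powi (- m - 1)) (- n - 1)"

definition sq_mode :: "'a::ab_group_add voa \<Rightarrow> 'a \<Rightarrow> int \<Rightarrow> 'a \<Rightarrow> 'a" where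
  "sq_mode V v n w =
     homog_ext V (\<lambda>k x. Sum_any (\<lambda>m. vscale V (sq_coeff k m n) (vmode V x m w))) v"

definition sq :: "'a::ab_group_add voa \<Rightarrow> 'a voa" where
  "sq V = \<lparr>vscale = vscale V, vmode = sq_mode V, vac = vac V,
           omega = omega V - vscale V (ccharge V / 24) (vac V), ccharge = ccharge V\<rparr>"

text \<open>Applied to \<open>sq V\<close>, the following properties single out the form
  \<open>\<langle>\<cdot>,\<cdot>\<rangle>\<^bsub>[]\<^esub>\<close>.\<close>

definition normalized_invariant_form ::
    "'a::ab_group_add voa \<Rightarrow> ('a \<Rightarrow> 'a \<Rightarrow> complex) \<Rightarrow> bool" where
  "normalized_invariant_form V F \<longleftrightarrow>
     (\<forall>a. Vector_Spaces.linear (vscale V) (*) (\<lambda>b. F a b)) \<and>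
     (\<forall>b. Vector_Spaces.linear (vscale V) (*) (\<lambda>a. F a b)) \<and>
     (\<forall>a b. F a b = F b a) \<and>
     (\<forall>a. (\<forall>b. F a b = 0) \<longrightarrow> a = 0) \<and>
     F (vac V) (vac V) = 1 \<and>
     (\<forall>u n a b. F (vmode V u n a) b = F a (adj_mode V u n b))"


section \<open>The vectors \<open>\<lambda>\<close>\<close>

text \<open>\<open>exp_vf a\<close> is \<open>exp (\<Sum>i. a\<^sub>i z^(i+1) \<partial>\<^sub>z) z\<close>, for \<open>a\<^sub>0 = 0\<close>.\<close>

definition exp_vf :: "(nat \<Rightarrow> rat) \<Rightarrow> rat fps" where
  "exp_vf a = Abs_fps (\<lambda>n. Sum_any (\<lambda>k.
     fps_nth (((\<lambda>f. fps_X * Abs_fps a * fps_deriv f) ^^ k) fps_X) n / fact k))"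

definition alpha :: "nat \<Rightarrow> rat" where
  "alpha = (THE a. a 0 = 0 \<and> exp_vf a = fps_exp 1 - 1)"

definition T_op :: "'a::ab_group_add voa \<Rightarrow> 'a \<Rightarrow> 'a" where
  "T_op V v = Sum_any (\<lambda>k. vscale V (1 / fact k)
     (((\<lambda>x. Sum_any (\<lambda>i. vscale V (of_rat (alpha i)) (Lm V (int i) x))) ^^ k) v))"

text \<open>\<open>T\<^sup>\<dagger>\<close> acts on the completion \<open>\<Prod>n. V\<^sub>n\<close>, whose elements are given by their families
  of weight components.\<close>

definition Tdag_op :: "'a::ab_group_add voa \<Rightarrow> (int \<Rightarrow> 'a) \<Rightarrow> (int \<Rightarrow> 'a)" where
  "Tdag_op V x = (\<lambda>n. Sum_any (\<lambda>k. vscale V (1 / fact k)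
     (((\<lambda>y m. Sum_any (\<lambda>i. vscale V (of_rat (alpha i)) (Lm V (- int i) (y (m - int i))))) ^^ k) x n)))"

definition lam :: "'a::ab_group_add voa \<Rightarrow> int \<Rightarrow> 'a" where
  "lam V = Tdag_op V (\<lambda>n. wpart V n (vac V))"

definition lam_tilde :: "'a::ab_group_add voa \<Rightarrow> nat \<Rightarrow> 'a" where
  "lam_tilde V n = T_op V (lam V (int n))"


section \<open>Partition functions\<close>

definition is_basis_of :: "'a::ab_group_add voa \<Rightarrow> 'a set \<Rightarrow> 'a set \<Rightarrow> bool" where
  "is_basis_of V W B \<longleftrightarrow>
     \<not> module.dependent (vscale V) B \<and> module.span (vscale V) B = W"

text \<open>The trace of an operator preserving the finite-dimensional subspace \<open>W\<close>.\<close>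

definition trace_on :: "'a::ab_group_add voa \<Rightarrow> 'a set \<Rightarrow> ('a \<Rightarrow> 'a) \<Rightarrow> complex" where
  "trace_on V W f =
     (let B = (SOME B. is_basis_of V W B)
      in \<Sum>b\<in>B. module.representation (vscale V) B (f b) b)"

definition zero_mode :: "'a::ab_group_add voa \<Rightarrow> 'a \<Rightarrow> 'a \<Rightarrow> 'a" where
  "zero_mode V u v = homog_ext V (\<lambda>k w. vmode V w (k - 1) v) u"

text \<open>A function \<open>f :: complex \<Rightarrow> complex\<close> stands for the formal series \<open>(\<Sum>s. f s * q^s)\<close> with
  complex exponents, and a function of two arguments for a series in \<open>q\<^sub>1\<close> and \<open>q\<^sub>2\<close>.
  In \<open>Tr (o(u) q^(L\<^sub>0 - C/24))\<close> the exponent \<open>s\<close> belongs to the \<open>L\<^sub>0\<close>-eigenvalue \<open>s + C/24\<close>.\<close>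

definition Z1 :: "'a::ab_group_add voa \<Rightarrow> 'a \<Rightarrow> complex \<Rightarrow> complex" where
  "Z1 V u s = trace_on V (eigsp V (s + ccharge V / 24)) (zero_mode V u)"

definition dual_vec :: "('a \<Rightarrow> 'a \<Rightarrow> complex) \<Rightarrow> 'a set \<Rightarrow> 'a set \<Rightarrow> 'a \<Rightarrow> 'a" where
  "dual_vec F W B u = (THE w. w \<in> W \<and> (\<forall>b\<in>B. F b w = (if b = u then 1 else 0)))"

text \<open>\<open>Z2 V F B\<close> is computed with the form \<open>F\<close> and the basis \<open>B n\<close> of \<open>V\<^bsub>[n]\<^esub>\<close> for each \<open>n\<close>;
  it is a power series in \<open>\<epsilon>\<close>.\<close>

definition Z2 ::
    "'a::ab_group_add voa \<Rightarrow> ('a \<Rightarrow> 'a \<Rightarrow> complex) \<Rightarrow> (nat \<Rightarrow> 'a set)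
     \<Rightarrow> (complex \<Rightarrow> complex \<Rightarrow> complex) fps" where
  "Z2 V F B = Abs_fps (\<lambda>n s1 s2. \<Sum>u\<in>B n.
     Z1 V u s1 * Z1 V (dual_vec F (wsp (sq V) (int n)) (B n) u) s2)"

definition q2_power_times ::
    "complex \<Rightarrow> (complex \<Rightarrow> complex \<Rightarrow> complex) fps \<Rightarrow> (complex \<Rightarrow> complex \<Rightarrow> complex) fps" where
  "q2_power_times c G = Abs_fps (\<lambda>n s1 s2. fps_nth G n s1 (s2 - c))"

text \<open>The coefficientwise limit \<open>q\<^sub>2 \<rightarrow> 0\<close>: each coefficient of \<open>\<epsilon>^n q\<^sub>1^s\<close> is a power series
  in \<open>q\<^sub>2\<close>, and its constant term is the limit.\<close>

definition has_q2_limit ::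
    "(complex \<Rightarrow> complex \<Rightarrow> complex) fps \<Rightarrow> (complex \<Rightarrow> complex) fps \<Rightarrow> bool" where
  "has_q2_limit G H \<longleftrightarrow>
     (\<forall>n s1. (\<forall>s2. fps_nth G n s1 s2 \<noteq> 0 \<longrightarrow> s2 \<in> \<nat>) \<and> fps_nth G n s1 0 = fps_nth H n s1)"

end

theory Submission
  imports Defs
begin

text \<open>
  The operator \<open>T = exp A\<close>, \<open>A = (\<Sum>i. \<alpha>\<^sub>i L\<^sub>i)\<close>, intertwines the two Virasoro actions, \<open>T L\<^sub>n = L[n] T\<close>.
  On the vector field side, \<open>ad A\<close> is the Lie bracket with \<open>p \<partial>\<close>, \<open>p = (\<Sum>i. \<alpha>\<^sub>i z^(i+1))\<close>; dually it is
  the Lie derivative of quadratic differentials, and its exponential pulls these back along the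
  time 1 flow \<open>e^z - 1\<close> of \<open>p \<partial>\<close>.  The central term is the Schwarzian derivative of \<open>e^z - 1\<close>,
  the constant \<open>-1/2\<close>, which accounts for \<open>\<omega> - C/24 1\<close>.

  Hence \<open>T V\<^sub>n = V\<^bsub>[n]\<^esub>\<close>, and \<open>L\<^sub>-\<^sub>n\<close> is adjoint to \<open>L\<^sub>n\<close> for the form \<open>\<langle>T a, T b\<rangle>\<^bsub>[]\<^esub>\<close>.  For
  \<open>u = T w\<close> with \<open>w \<in> V\<^sub>n\<close> this gives
  \<open>\<langle>T \<lambda>\<^sup>(\<^sup>n\<^sup>), T w\<rangle> = \<langle>T T\<^sup>\<dagger> 1, T w\<rangle> = \<langle>1, T (T w)\<rangle> = \<langle>1, T u\<rangle>\<close>, the coefficient of \<open>1\<close> in the weight 0 part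
  of \<open>u\<close>.  As \<open>V\<^sub>0 = \<complex> 1\<close>, that coefficient is the trace of \<open>o(u)\<close> on \<open>V\<^sub>0\<close>, i.e. the constant term of
  \<open>q^(C/24) Z\<^sup>(\<^sup>1\<^sup>)(u,q)\<close>.  The coefficients of
  \<open>T \<lambda>\<^sup>(\<^sup>n\<^sup>)\<close> in the given basis of \<open>V\<^bsub>[n]\<^esub>\<close> are its products with the dual basis, whence the claim.
\<close>

section \<open>Flows of formal vector fields\<close>

text \<open>Lower bounds for the orders are easier to carry along than exact subdegrees, and they
  also cover a zero factor.\<close>

lemma fls_times_nth_bounds:
  fixes f g :: "'a::comm_semiring_0 fls"
  assumes f: "\<And>n. n < N \<Longrightarrow> fls_nth f n = 0" and g: "\<And>n. n < M \<Longrightarrow> fls_nth g n = 0"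
  shows "fls_nth (f * g) n = (\<Sum>i=N..n - M. fls_nth f i * fls_nth g (n - i))"
proof (cases "f = 0 \<or> g = 0")
  case True
  then show ?thesis by auto
next
  case False
  have "N \<le> fls_subdegree f" "M \<le> fls_subdegree g"
    using False f g by (metis linorder_not_le nth_fls_subdegree_nonzero)+
  then have "(\<Sum>i=fls_subdegree f..n - fls_subdegree g. fls_nth f i * fls_nth g (n - i))
     = (\<Sum>i=N..n - M. fls_nth f i * fls_nth g (n - i))"
    by (intro sum.mono_neutral_left) (auto simp: not_le)
  then show ?thesis by (simp add: fls_times_nth(2))
qed

text \<open>A power series in \<open>t\<close> over Laurent series in \<open>z\<close> can be evaluated at \<open>t = 1\<close>, which is
  \<open>tsum\<close>, if the \<open>z\<close>-orders of its coefficients grow; \<open>tsum\<close> is then multiplicative.\<close>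

definition grow :: "'a::zero fls fps \<Rightarrow> int \<Rightarrow> bool" where
  "grow x N \<longleftrightarrow> (\<forall>k m. m < N + int k \<longrightarrow> fls_nth (fps_nth x k) m = 0)"

definition tsum :: "'a::comm_monoid_add fls fps \<Rightarrow> 'a fls" where
  "tsum x = Abs_fls (\<lambda>m. Sum_any (\<lambda>k. fls_nth (fps_nth x k) m))"

lemma growD: "grow x N \<Longrightarrow> m < N + int k \<Longrightarrow> fls_nth (fps_nth x k) m = 0"
  by (simp add: grow_def)

lemma grow_mono: "grow x N \<Longrightarrow> M \<le> N \<Longrightarrow> grow x M"
  by (simp add: grow_def)

lemma tsum_nth_Sum_any:
  assumes "grow x N"
  shows "fls_nth (tsum x) m = Sum_any (\<lambda>k. fls_nth (fps_nth x k) m)"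
proof -
  have "Sum_any (\<lambda>k. fls_nth (fps_nth x k) m) = 0" if "m < N" for m
    using growD[OF assms] that by (auto intro!: Sum_any.neutral)
  then show ?thesis unfolding tsum_def by (subst nth_Abs_fls_lower_bound[of N]) auto
qed

lemma tsum_nth:
  assumes "grow x N" and "m < N + int K"
  shows "fls_nth (tsum x) m = (\<Sum>k<K. fls_nth (fps_nth x k) m)"
proof -
  have "{k. fls_nth (fps_nth x k) m \<noteq> 0} \<subseteq> {..<K}"
    using growD[OF assms(1)] assms(2) by (force simp: not_less)
  then show ?thesis
    by (simp add: tsum_nth_Sum_any[OF assms(1)] Sum_any.expand_superset)
qed

lemma tsum_nth_eq_0: "grow x N \<Longrightarrow> m < N \<Longrightarrow> fls_nth (tsum x) m = 0"
  using tsum_nth[of x N m 0] by simp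

lemma grow_mult:
  fixes x y :: "'a::comm_semiring_0 fls fps"
  assumes x: "grow x N" and y: "grow y M"
  shows "grow (x * y) (N + M)"
  unfolding grow_def
proof (intro allI impI)
  fix k m assume m: "m < N + M + int k"
  have "fls_nth (fps_nth x i * fps_nth y (k - i)) m = 0" if "i \<le> k" for i
    using that m growD[OF x] growD[OF y]
    by (subst fls_times_nth_bounds[where N = "N + int i" and M = "M + int (k - i)"])
       (auto simp: of_nat_diff)
  then show "fls_nth (fps_nth (x * y) k) m = 0"
    by (simp add: fps_mult_nth fls_nth_sum)
qed

text \<open>At a fixed order in \<open>z\<close> only finitely many index pairs contribute, so the
  triangle of the Cauchy product can be enlarged to a square, where the double sum factors.\<close>

lemma tsum_mult:
  fixes x y :: "'a::comm_semiring_0 fls fps"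
  assumes x: "grow x N" and y: "grow y M"
  shows "tsum (x * y) = tsum x * tsum y"
proof (rule fls_eqI)
  fix m
  define K where "K = nat (m - N - M + 1)"
  have K: "m < N + M + int K" by (simp add: K_def)
  have K1: "i < N + int K" "m - i < M + int K" if "i \<in> {N..m - M}" for i
    using that by (auto simp: K_def)
  define t where "t i j = (\<Sum>a=N..m - M. fls_nth (fps_nth x i) a * fls_nth (fps_nth y j) (m - a))" for i j
  have t: "fls_nth (fps_nth x i * fps_nth y j) m = t i j" for i j
    unfolding t_def using growD[OF x] growD[OF y] by (subst fls_times_nth_bounds) auto
  \<comment> \<open>For large \<open>i + j\<close> one of the two factors always lies below its
    growth bound.\<close>
  have t0: "t i j = 0" if "K \<le> i + j" for i j
    unfolding t_def
  proof (intro sum.neutral ballI)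
    fix a assume "a \<in> {N..m - M}"
    have "a < N + int i \<or> m - a < M + int j" using that K by linarith
    then show "fls_nth (fps_nth x i) a * fls_nth (fps_nth y j) (m - a) = 0"
      using growD[OF x] growD[OF y] by auto
  qed
  have "fls_nth (tsum (x * y)) m = (\<Sum>k<K. fls_nth (fps_nth (x * y) k) m)"
    using tsum_nth[OF grow_mult[OF x y] K] .
  also have "\<dots> = (\<Sum>k<K. \<Sum>i\<le>k. t i (k - i))"
    by (simp add: fps_mult_nth fls_nth_sum t atLeast0AtMost)
  also have "\<dots> = (\<Sum>(i,j)\<in>{(i,j). i + j < K}. t i j)"
    by (simp add: sum.triangle_reindex)
  also have "\<dots> = (\<Sum>(i,j)\<in>{..<K} \<times> {..<K}. t i j)"
    using t0 by (intro sum.mono_neutral_left) (auto, metis not_le)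
  also have "\<dots> = (\<Sum>i<K. \<Sum>j<K. t i j)" by (simp add: sum.cartesian_product)
  also have "\<dots> = (\<Sum>i<K. \<Sum>a=N..m - M. \<Sum>j<K. fls_nth (fps_nth x i) a * fls_nth (fps_nth y j) (m - a))"
    unfolding t_def by (intro sum.cong refl sum.swap)
  also have "\<dots> = (\<Sum>a=N..m - M. \<Sum>i<K. \<Sum>j<K. fls_nth (fps_nth x i) a * fls_nth (fps_nth y j) (m - a))"
    by (rule sum.swap)
  also have "\<dots> = (\<Sum>a=N..m - M. fls_nth (tsum x) a * fls_nth (tsum y) (m - a))"
    by (intro sum.cong refl) (simp add: sum_product tsum_nth[OF x K1(1)] tsum_nth[OF y K1(2)])
  also have "\<dots> = fls_nth (tsum x * tsum y) m"
    using tsum_nth_eq_0[OF x] tsum_nth_eq_0[OF y] by (subst fls_times_nth_bounds) auto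
  finally show "fls_nth (tsum (x * y)) m = fls_nth (tsum x * tsum y) m" .
qed

lemma grow_const: 
  assumes "\<And>n. n < N \<Longrightarrow> fls_nth f n = 0"
  shows "grow (fps_const f) N"
  using assms by (auto simp: grow_def)

lemma tsum_const: 
  shows "tsum (fps_const f) = (f :: 'a::comm_monoid_add fls)"
proof (rule fls_eqI)
  fix m
  obtain N where "\<And>n. n < N \<Longrightarrow> fls_nth f n = 0" using fls_nth_vanishes_belowE by blast
  then have g: "grow (fps_const f) (min N m)" by (auto intro: grow_const)
  show "fls_nth (tsum (fps_const f)) m = fls_nth f m"
    by (subst tsum_nth[OF g, of _ "Suc (nat (m - min N m))"]) (auto simp: sum.lessThan_Suc_shift simp del: sum.lessThan_Suc)
qed

lemma tsum_cmult:
  fixes x :: "'a::comm_semiring_0 fls fps"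
  assumes "grow x N"
  shows "tsum (fps_const f * x) = f * tsum x"
proof -
  obtain M where "\<And>n. n < M \<Longrightarrow> fls_nth f n = 0" using fls_nth_vanishes_belowE by blast
  then show ?thesis using tsum_mult[OF grow_const[of M f] assms] by (simp add: tsum_const)
qed

lemma tsum_add:
  fixes x y :: "'a::comm_semiring_0 fls fps"
  assumes x: "grow x N" and y: "grow y M"
  shows "tsum (x + y) = tsum x + tsum y"
proof (rule fls_eqI)
  fix m
  have x': "grow x (min N M)" and y': "grow y (min N M)" using x y by (auto intro: grow_mono)
  have xy: "grow (x + y) (min N M)" using growD[OF x'] growD[OF y'] by (simp add: grow_def)
  have K: "m < min N M + int (nat (m - min N M + 1))" by auto
  show "fls_nth (tsum (x + y)) m = fls_nth (tsum x + tsum y) m"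
    by (simp add: tsum_nth[OF x' K] tsum_nth[OF y' K] tsum_nth[OF xy K] sum.distrib)
qed

lemma grow_deriv:
  assumes "grow x N" shows "grow (Abs_fps (\<lambda>k. fls_deriv (fps_nth x k))) (N - 1)"
  using growD[OF assms] by (auto simp: grow_def)

lemma tsum_deriv:
  assumes x: "grow x N"
  shows "tsum (Abs_fps (\<lambda>k. fls_deriv (fps_nth x k))) = fls_deriv (tsum x)"
proof (rule fls_eqI)
  fix m
  have K: "m < N - 1 + int (nat (m - N + 2))" "m + 1 < N + int (nat (m - N + 2))" by auto
  show "fls_nth (tsum (Abs_fps (\<lambda>k. fls_deriv (fps_nth x k)))) m = fls_nth (fls_deriv (tsum x)) m"
    by (simp add: tsum_nth[OF grow_deriv[OF x] K(1)] tsum_nth[OF x K(2)] sum_distrib_left)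
qed

text \<open>Dividing by \<open>t\<close> has no effect at \<open>t = 1\<close>, so only the dropped
  constant term is lost. Together with \<open>flow\<close> this handles the series for
  \<open>(exp X - 1) / X\<close> that underlies \<open>schw\<close>.\<close>

lemma tsum_shift:
  fixes x :: "'a::ab_group_add fls fps"
  assumes x: "grow x N"
  shows "grow (fps_shift 1 x) (N + 1)" and "tsum (fps_shift 1 x) = tsum x - fps_nth x 0"
proof -
  show g: "grow (fps_shift 1 x) (N + 1)" using growD[OF x] by (simp add: grow_def)
  show "tsum (fps_shift 1 x) = tsum x - fps_nth x 0"
  proof (rule fls_eqI)
    fix m
    define K where "K = nat (m - N + 1)"
    have K: "m < N + 1 + int K" "m < N + int (Suc K)" by (auto simp: K_def)
    show "fls_nth (tsum (fps_shift 1 x)) m = fls_nth (tsum x - fps_nth x 0) m"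
      using tsum_nth[OF g K(1)] tsum_nth[OF x K(2)]
      by (simp add: sum.lessThan_Suc_shift del: sum.lessThan_Suc)
  qed
qed

lemma fls_const_fact: "fls_const (fact k) = (fact k :: 'a::semiring_char_0 fls)"
  by (metis fls_of_nat of_nat_fact)

lemma fls_divide_fact_nth:
  fixes f :: "'a::field_char_0 fls"
  shows "fls_nth (f / fact k) m = fls_nth f m / fact k"
  by (simp add: divide_inverse fls_inverse_const flip: fls_const_fact)

text \<open>\<open>tvec p a\<close> is the Lie derivative along \<open>p \<partial>\<close> on densities of weight \<open>a\<close>,
  and \<open>flow p a f\<close> is \<open>exp (t * tvec p a) f\<close> as a power series in \<open>t\<close>.\<close>

definition tvec :: "'a::comm_ring_1 fls \<Rightarrow> nat \<Rightarrow> 'a fls \<Rightarrow> 'a fls" where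
  "tvec p a f = p * fls_deriv f + of_nat a * fls_deriv p * f"

definition flow :: "'a::field_char_0 fls \<Rightarrow> nat \<Rightarrow> 'a fls \<Rightarrow> 'a fls fps" where
  "flow p a f = Abs_fps (\<lambda>k. (tvec p a ^^ k) f / fact k)"

lemma tvec_add: "tvec p a (f + g) = tvec p a f + tvec p a g"
  by (simp add: tvec_def algebra_simps)

lemma tvec_diff: "tvec p a (f - g) = tvec p a f - tvec p a g"
  by (simp add: tvec_def algebra_simps)

lemma tvec_0: "tvec p a 0 = 0"
  by (simp add: tvec_def)

lemma tvec_sum: "tvec p a (sum f A) = (\<Sum>i\<in>A. tvec p a (f i))"
  by (induction A rule: infinite_finite_induct) (simp_all add: tvec_add tvec_0)

lemma tvec_mult: "tvec p (a + b) (f * g) = tvec p a f * g + f * tvec p b g"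
  by (simp add: tvec_def algebra_simps)

lemma tvec_const_mult: "fls_deriv c = 0 \<Longrightarrow> tvec p a (c * f) = c * tvec p a f"
  by (simp add: tvec_def algebra_simps)

lemma tvec_div_of_nat:
  fixes f :: "'a::field_char_0 fls"
  shows "tvec p a (f / of_nat k) = tvec p a f / of_nat k"
  using tvec_const_mult[of "inverse (of_nat k)" p a f]
  by (simp add: fls_inverse_deriv divide_inverse mult.commute)

lemma fls_deriv_tvec_0: "fls_deriv (tvec p 0 f) = tvec p 1 (fls_deriv f)"
  by (simp add: tvec_def algebra_simps)

lemma flow_0 [simp]: "fps_nth (flow p a f) 0 = f"
  by (simp add: flow_def)

lemma flow_Suc: "of_nat (Suc k) * fps_nth (flow p a f) (Suc k) = tvec p a (fps_nth (flow p a f) k)"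
  using tvec_div_of_nat[of p a "(tvec p a ^^ k) f" "fact k"]
  by (simp add: flow_def field_simps del: of_nat_Suc)

text \<open>The recursion is the differential equation \<open>dx/dt = tvec p a x\<close>, read
  coefficientwise. The identities for \<open>flow\<close> below follow by checking that both sides
  solve it.\<close>

lemma flow_unique:
  assumes "fps_nth x 0 = f" and "\<And>k. of_nat (Suc k) * fps_nth x (Suc k) = tvec p a (fps_nth x k)"
  shows "x = flow p a f"
proof (rule fps_ext)
  fix k show "fps_nth x k = fps_nth (flow p a f) k"
  proof (induction k)
    case (Suc k)
    then have "of_nat (Suc k) * fps_nth x (Suc k) = of_nat (Suc k) * fps_nth (flow p a f) (Suc k)"
      by (simp only: assms(2) flow_Suc)
    then show ?case by (simp del: of_nat_Suc)
  qed (simp add: assms(1))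
qed

text \<open>By the Leibniz rule \<open>tvec_mult\<close>, in which the weights of densities add, the
  product of two solutions is again a solution.\<close>

lemma flow_mult: "flow p (a + b) (f * g) = flow p a f * flow p b g"
proof (rule flow_unique[symmetric])
  fix k
  let ?x = "flow p a f" and ?y = "flow p b g"
  have d: "fps_nth (fps_deriv (flow p c h)) i = tvec p c (fps_nth (flow p c h) i)" for c h i
    using flow_Suc[of i p c h] by simp
  have "of_nat (Suc k) * fps_nth (?x * ?y) (Suc k) = fps_nth (fps_deriv (?x * ?y)) k"
    by (simp only: fps_deriv_nth Suc_eq_plus1)
  also have "\<dots> = fps_nth (?x * fps_deriv ?y + fps_deriv ?x * ?y) k"
    by (simp only: fps_deriv_mult)
  also have "\<dots> = (\<Sum>i=0..k. tvec p (a + b) (fps_nth ?x i * fps_nth ?y (k - i)))"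
    unfolding fps_add_nth fps_mult_nth d tvec_mult
    by (simp add: sum.distrib add.commute)
  also have "\<dots> = tvec p (a + b) (fps_nth (?x * ?y) k)"
    by (simp add: fps_mult_nth tvec_sum)
  finally show "of_nat (Suc k) * fps_nth (?x * ?y) (Suc k) = tvec p (a + b) (fps_nth (?x * ?y) k)" .
qed simp

text \<open>The derivative of a function is a density of weight 1, and taking it commutes with Lie
  derivatives.\<close>

lemma flow_deriv: "Abs_fps (\<lambda>k. fls_deriv (fps_nth (flow p 0 f) k)) = flow p 1 (fls_deriv f)"
proof (rule flow_unique)
  fix k
  show "of_nat (Suc k) * fps_nth (Abs_fps (\<lambda>k. fls_deriv (fps_nth (flow p 0 f) k))) (Suc k) =
        tvec p 1 (fps_nth (Abs_fps (\<lambda>k. fls_deriv (fps_nth (flow p 0 f) k))) k)"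
    using arg_cong[OF flow_Suc[of k p 0 f], of fls_deriv]
    by (simp add: fls_deriv_tvec_0 del: of_nat_Suc)
qed simp

lemma flow_tvec: "flow p a (tvec p a f) = Abs_fps (\<lambda>k. tvec p a (fps_nth (flow p a f) k))"
proof (rule flow_unique[symmetric])
  fix k
  show "of_nat (Suc k) * fps_nth (Abs_fps (\<lambda>k. tvec p a (fps_nth (flow p a f) k))) (Suc k) =
    tvec p a (fps_nth (Abs_fps (\<lambda>k. tvec p a (fps_nth (flow p a f) k))) k)"
    using arg_cong[OF flow_Suc[of k p a f], of "tvec p a"]
    by (simp add: tvec_const_mult del: of_nat_Suc)
qed simp

text \<open>Since \<open>p\<close> vanishes to order 2 at the origin, every application of
  \<open>tvec p a\<close> raises the order in \<open>z\<close>; this is what allows setting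
  \<open>t = 1\<close>.\<close>

lemma grow_flow:
  assumes p: "\<And>n. n < 2 \<Longrightarrow> fls_nth p n = 0" and f: "\<And>n. n < N \<Longrightarrow> fls_nth f n = 0"
  shows "grow (flow p a f) N"
proof -
  have step: "fls_nth (tvec p a g) n = 0" if g: "\<And>n. n < M \<Longrightarrow> fls_nth g n = 0" and n: "n < M + 1" for g M n
  proof -
    have "fls_nth (p * fls_deriv g) n = 0" using n p g
      by (subst fls_times_nth_bounds[where N = 2 and M = "M - 1"]) auto
    moreover have "fls_nth (fls_deriv p * g) n = 0" using n p g
      by (subst fls_times_nth_bounds[where N = 1 and M = "M"]) auto
    ultimately show ?thesis by (simp add: tvec_def mult.assoc fls_of_nat)
  qed
  have "fls_nth ((tvec p a ^^ k) f) m = 0" if "m < N + int k" for k m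
    using that
  proof (induction k arbitrary: m)
    case (Suc k)
    then show ?case using step[of "N + int k" "(tvec p a ^^ k) f" m] by simp
  qed (use f in auto)
  then show ?thesis
    by (simp add: grow_def flow_def fls_divide_fact_nth)
qed


lemma tsum_tvec:
  fixes x :: "'a::comm_ring_1 fls fps"
  assumes x: "grow x N"
  shows "tsum (Abs_fps (\<lambda>k. tvec p a (fps_nth x k))) = tvec p a (tsum x)"
proof -
  let ?d = "Abs_fps (\<lambda>k. fls_deriv (fps_nth x k))"
  have eq: "Abs_fps (\<lambda>k. tvec p a (fps_nth x k)) =
      fps_const p * ?d + fps_const (of_nat a * fls_deriv p) * x"
    by (rule fps_ext) (simp add: tvec_def mult.assoc)
  obtain M M' where M: "\<And>n. n < M \<Longrightarrow> fls_nth p n = 0"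
    and M': "\<And>n. n < M' \<Longrightarrow> fls_nth (of_nat a * fls_deriv p) n = 0"
    using fls_nth_vanishes_belowE by metis
  show ?thesis
    unfolding eq
    using tsum_add[OF grow_mult[OF grow_const[OF M] grow_deriv[OF x]] grow_mult[OF grow_const[OF M'] x]]
    by (simp add: tsum_cmult[OF x] tsum_cmult[OF grow_deriv[OF x]] tsum_deriv[OF x] tvec_def mult.assoc)
qed

text \<open>This is minus the usual bracket of \<open>p \<partial>\<close> and
  \<open>f \<partial>\<close>. The sign agrees with the commutators of the operators
  \<open>L\<^sub>m\<close>; see \<open>psi_commutator\<close>.\<close>

definition lie :: "'a::comm_ring_1 fls \<Rightarrow> 'a fls \<Rightarrow> 'a fls" where
  "lie p f = fls_deriv p * f - p * fls_deriv f"

text \<open>Vector fields and quadratic differentials are dual under the residue pairing.\<close>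

lemma residue_lie_power:
  "fls_nth (g * (lie p ^^ k) f) (-1) = fls_nth ((tvec p 2 ^^ k) g * f) (-1)"
proof (induction k arbitrary: g)
  case (Suc k)
  let ?f = "(lie p ^^ k) f"
  \<comment> \<open>The two sides of the duality differ by an exact derivative, which has no
    residue.\<close>
  have "tvec p 2 g * ?f - g * lie p ?f = fls_deriv (p * g * ?f)"
    by (simp add: tvec_def lie_def algebra_simps)
  then have "fls_nth (g * lie p ?f) (-1) = fls_nth (tvec p 2 g * ?f) (-1)"
    by (metis fls_deriv_residue fls_minus_nth eq_iff_diff_eq_0)
  also have "\<dots> = fls_nth ((tvec p 2 ^^ k) (tvec p 2 g) * f) (-1)"
    by (rule Suc.IH)
  finally show ?case by (simp add: funpow_swap1)
qed simp

lemma lie_nth_eq_0: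
  assumes p: "\<And>n. n < 2 \<Longrightarrow> fls_nth p n = 0" and g: "\<And>n. n < M \<Longrightarrow> fls_nth g n = 0"
    and n: "n < M + 1"
  shows "fls_nth (lie p g) n = 0"
proof -
  have "fls_nth (p * fls_deriv g) n = 0" using n p g
    by (subst fls_times_nth_bounds[where N = 2 and M = "M - 1"]) auto
  moreover have "fls_nth (fls_deriv p * g) n = 0" using n p g
    by (subst fls_times_nth_bounds[where N = 1 and M = "M"]) auto
  ultimately show ?thesis by (simp add: lie_def)
qed

lemma lie_power_nth_eq_0:
  assumes p: "\<And>n. n < 2 \<Longrightarrow> fls_nth p n = 0" and g: "\<And>n. n < M \<Longrightarrow> fls_nth g n = 0"
    and n: "n < M + int k"
  shows "fls_nth ((lie p ^^ k) g) n = 0"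
  using n
proof (induction k arbitrary: n)
  case (Suc k)
  then show ?case using lie_nth_eq_0[OF p, of "M + int k" "(lie p ^^ k) g" n] by simp
qed (use g in simp)

lemma fls_X_intpow_residue:
  fixes f :: "'a::comm_ring_1 fls"
  shows "fls_nth (fls_X_intpow i * f) (-1) = fls_nth f (-i-1)"
  and "fls_nth (f * fls_X_intpow i) (-1) = fls_nth f (-i-1)"
proof -
  have *: "- 1 - i = - i - 1" by simp
  show "fls_nth (fls_X_intpow i * f) (-1) = fls_nth f (-i-1)"
    and "fls_nth (f * fls_X_intpow i) (-1) = fls_nth f (-i-1)"
    by (simp_all add: fls_X_intpow_times_conv_shift) (simp_all only: *)
qed

section \<open>Pullback along \<open>e^z - 1\<close> and its Schwarzian derivative\<close>

locale exp_flow =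
  fixes p :: "'a::field_char_0 fls"
  assumes p: "\<And>n. n < 2 \<Longrightarrow> fls_nth p n = 0"
    and flow_X: "tsum (flow p 0 fls_X) = fps_to_fls (fps_exp 1 - 1)"
begin

text \<open>The flow at time 1, that is, the pullback of densities of weight \<open>a\<close> along
  \<open>e^z - 1\<close>. The explicit forms are \<open>E_X_intpow\<close>, \<open>E1\<close> and
  \<open>E2\<close>.\<close>

definition E :: "nat \<Rightarrow> 'a fls \<Rightarrow> 'a fls" where
  "E a f = tsum (flow p a f)"

lemma grow_flow_ex: obtains N where "grow (flow p a f) N"
  using grow_flow[OF p] fls_nth_vanishes_belowE by metis

lemma E_mult: "E (a + b) (f * g) = E a f * E b g"
  unfolding E_def flow_mult by (metis tsum_mult grow_flow_ex)

lemma E_deriv: "fls_deriv (E 0 f) = E 1 (fls_deriv f)"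
  unfolding E_def flow_deriv[symmetric] by (metis tsum_deriv grow_flow_ex)

lemma E_tvec: "E a (tvec p a f) = tvec p a (E a f)"
  unfolding E_def flow_tvec by (metis tsum_tvec grow_flow_ex)

lemma E_X: "E 0 fls_X = fps_to_fls (fps_exp 1 - 1)"
  using flow_X by (simp add: E_def)

lemma exp_minus_1_nonzero: "fps_to_fls (fps_exp 1 - 1 :: 'a fps) \<noteq> 0"
proof -
  have "fps_nth (fps_exp 1 - 1 :: 'a fps) 1 \<noteq> fps_nth 0 1" by simp
  then show ?thesis by (metis fps_to_fls_eq_0_iff)
qed

text \<open>By multiplicativity, multiplication by \<open>E 0 1\<close> fixes the nonzero series
  \<open>E 0 fls_X\<close>.\<close>

lemma E_one: "E 0 1 = 1"
  using E_mult[of 0 0 1 fls_X] exp_minus_1_nonzero by (simp add: E_X)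

lemma E_X_power: "E 0 (fls_X ^ n) = fps_to_fls (fps_exp 1 - 1) ^ n"
  using E_mult[of 0 0 fls_X] by (induction n) (simp_all add: E_one E_X)

lemma E_X_intpow: "E 0 (fls_X_intpow k) = fps_to_fls (fps_exp 1 - 1) powi k"
proof (cases "k \<ge> 0")
  case True
  then show ?thesis
    using E_X_power[of "nat k"] by (simp add: power_int_def fls_X_power_conv_shift_1)
next
  case False
  have "fls_X_intpow k * fls_X ^ nat (-k) = (1 :: 'a fls)"
    using False fls_X_intpow_times_fls_X_intpow[of k "-k"]
    by (simp add: fls_X_power_conv_shift_1)
  then have "E 0 (fls_X_intpow k) * fps_to_fls (fps_exp 1 - 1) ^ nat (-k) = 1"
    using E_mult[of 0 0 "fls_X_intpow k" "fls_X ^ nat (-k)"] by (simp add: E_one E_X_power)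
  then show ?thesis
    using False exp_minus_1_nonzero by (simp add: power_int_def power_inverse field_simps)
qed

abbreviation e :: "'a fls" where "e \<equiv> fps_to_fls (fps_exp 1)"

lemma e_nonzero: "e \<noteq> 0"
  using fps_exp_neq_0 by simp

lemma deriv_e: "fls_deriv e = e"
  by (simp add: fls_deriv_fps_to_fls)

lemma E1_one: "E 1 1 = e"
  using E_deriv[of fls_X] by (simp add: E_X deriv_e flip: fls_deriv_fps_to_fls)

lemma E1: "E 1 f = e * E 0 f"
  using E_mult[of 1 0 1 f] by (simp add: E1_one del: One_nat_def)

lemma E2: "E 2 f = e\<^sup>2 * E 0 f"
  using E_mult[of 1 1 1 f]
  by (simp add: E1_one E1 E_one power2_eq_square nat_1_add_1 mult.assoc del: One_nat_def)

text \<open>The cocycle computation: the flow preserves \<open>p\<close>, i.e. \<open>p(e^z - 1) = p(z) e^z\<close>, and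
  differentiating three times gives the Schwarzian derivative \<open>-1/2\<close> of \<open>e^z - 1\<close>.\<close>

lemma E2_deriv3_p:
  "E 2 (fls_deriv (fls_deriv (fls_deriv p))) = fls_deriv (fls_deriv (fls_deriv p)) - fls_deriv p"
proof -
  let ?p1 = "fls_deriv p"
  let ?p2 = "fls_deriv ?p1"
  let ?p3 = "fls_deriv ?p2"
  \<comment> \<open>The chain rule for composition with \<open>e^z - 1\<close>, whose derivative is
    \<open>e\<close>.\<close>
  have E': "e * E 0 (fls_deriv f) = fls_deriv (E 0 f)" for f
    by (simp add: E_deriv E1 del: One_nat_def)
  \<comment> \<open>Here \<open>p\<close> is \<open>tvec p 0 fls_X\<close>, and the generator
    commutes with its own flow.\<close>
  have p0: "E 0 p = p * e"
    using E_tvec[of 0 fls_X] by (simp add: tvec_def E_X deriv_e flip: fls_deriv_fps_to_fls)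
  have "e * E 0 ?p1 = e * (?p1 + p)"
    unfolding E' p0 by (simp add: deriv_e algebra_simps)
  then have p1: "E 0 ?p1 = ?p1 + p" using e_nonzero by simp
  have p2: "e * E 0 ?p2 = ?p2 + ?p1"
    unfolding E' p1 by simp
  have "e * E 0 ?p2 + e * (e * E 0 ?p3) = fls_deriv (e * E 0 ?p2)"
    unfolding fls_deriv_mult deriv_e E'[of "?p2"] by simp
  also have "\<dots> = ?p3 + ?p2" unfolding p2 by simp
  finally show ?thesis unfolding p2 by (simp add: E2 power2_eq_square algebra_simps)
qed

text \<open>At \<open>t = 1\<close> this is \<open>(exp X - 1) / X\<close> with
  \<open>X = tvec p 2\<close>, applied to the third derivative of \<open>p\<close>: the
  infinitesimal Schwarzian cocycle integrated along the flow.\<close>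

definition schw :: "'a fls fps" where
  "schw = Abs_fps (\<lambda>k. (tvec p 2 ^^ k) (fls_deriv (fls_deriv (fls_deriv p))) / fact (Suc k))"

lemma grow_schw: "grow schw 0"
proof -
  have "grow (flow p 2 (fls_deriv (fls_deriv (fls_deriv p)))) 0"
  proof (rule grow_flow)
    show "fls_nth (fls_deriv (fls_deriv (fls_deriv p))) n = 0" if "n < 0" for n
      using that p[of "n + 3"] by (cases "n = -1") (auto simp: add.commute)
  qed (use p in auto)
  then show ?thesis
    by (simp add: grow_def schw_def flow_def fls_divide_fact_nth del: fact_Suc)
qed

text \<open>A trivial flow would fix \<open>z\<close>, but \<open>e^z - 1\<close> has a nonzero
  coefficient at \<open>z^2\<close>.\<close>

lemma p_nonzero: "p \<noteq> 0"
proof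
  assume "p = 0"
  then have "flow p 0 fls_X = fps_const fls_X"
    by (intro flow_unique[symmetric]) (simp_all add: tvec_def)
  then have "fls_X = fps_to_fls (fps_exp 1 - 1 :: 'a fps)"
    using flow_X tsum_const by metis
  then have "fls_nth fls_X 2 = fls_nth (fps_to_fls (fps_exp 1 - 1 :: 'a fps)) 2" by simp
  then show False by simp
qed

text \<open>Applying \<open>tvec p 2\<close> cancels the denominator of
  \<open>(exp X - 1) / X\<close>, so \<open>E2_deriv3_p\<close> gives the image of the sum. The
  constant \<open>-1/2\<close> has the same image, and the order at the origin leaves no room for a
  difference.\<close>

lemma tsum_schw: "tsum schw = fls_const (- (1 / 2))"
proof -
  let ?p3 = "fls_deriv (fls_deriv (fls_deriv p))"
  obtain N where N: "grow (flow p 2 ?p3) N" by (rule grow_flow_ex)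
  have "Abs_fps (\<lambda>k. tvec p 2 (fps_nth schw k)) = fps_shift 1 (flow p 2 ?p3)"
  proof (rule fps_ext)
    fix k
    show "fps_nth (Abs_fps (\<lambda>k. tvec p 2 (fps_nth schw k))) k = fps_nth (fps_shift 1 (flow p 2 ?p3)) k"
      using tvec_div_of_nat[of p 2 "(tvec p 2 ^^ k) ?p3" "fact (Suc k)"]
      by (simp add: schw_def flow_def del: fact_Suc)
  qed
  then have "tvec p 2 (tsum schw) = E 2 ?p3 - ?p3"
    using tsum_tvec[OF grow_schw, of p 2] tsum_shift(2)[OF N] by (simp add: E_def)
  then have "tvec p 2 (tsum schw) = - fls_deriv p" by (simp add: E2_deriv3_p)
  moreover have "tvec p 2 (fls_const (- (1 / 2))) = - fls_deriv p"
  proof -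
    have "2 * fls_const (- (1 / 2)) = (- 1 :: 'a fls)"
      using fls_const_mult_const[of 2 "- (1/2) :: 'a"] by simp
    moreover have "tvec p 2 (fls_const c) = fls_deriv p * (2 * fls_const c)" for c
      by (simp add: tvec_def)
    ultimately show ?thesis by (simp only: mult_minus1_right)
  qed
  ultimately have "tvec p 2 (tsum schw - fls_const (- (1 / 2))) = 0"
    by (simp only: tvec_diff diff_self)
  \<comment> \<open>As \<open>Y\<close> is killed by \<open>tvec p 2\<close>, the product
    \<open>p * p * Y\<close> is constant. It has order at least 4, because \<open>Y\<close> has no
    negative powers, so it vanishes.\<close>
  moreover define Y where "Y = tsum schw - fls_const (- (1 / 2))"
  ultimately have "fls_deriv (p * p * Y) = 0"
  proof -
    assume "tvec p 2 (tsum schw - fls_const (- (1 / 2))) = 0"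
    then have "p * tvec p 2 Y = 0" by (simp add: Y_def)
    then show ?thesis by (simp add: tvec_def algebra_simps)
  qed
  then obtain c where c: "p * p * Y = fls_const c"
    using fls_deriv_eq_0_iff by metis
  have "fls_nth Y n = 0" if "n < 0" for n
    using that tsum_nth_eq_0[OF grow_schw] by (simp add: Y_def)
  moreover have "fls_nth (p * p) n = 0" if "n < 4" for n
    using that p by (subst fls_times_nth_bounds[where N = 2 and M = 2]) auto
  ultimately have "fls_nth (p * p * Y) 0 = 0"
    by (subst fls_times_nth_bounds[where N = 4 and M = 0]) auto
  then have "c = 0" using c by simp
  then have "Y = 0" using c p_nonzero by simp
  then show ?thesis unfolding Y_def by (simp only: eq_iff_diff_eq_0[symmetric])
qed

text \<open>Pairing with the quadratic differential \<open>z^(-m-2)\<close> extracts a coefficient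
  of the transported vector field, and residue duality moves the flow onto that differential. The
  right-hand side is \<open>sq_coeff 2 (m + 1) (n + 1)\<close>.\<close>

lemma lie_flow_nth:
  "Sum_any (\<lambda>k. fls_nth ((lie p ^^ k) (fls_X_intpow (n + 1))) (m + 1) / fact k) =
   fls_nth (fps_to_fls (fps_exp 2) * fps_to_fls (fps_exp 1 - 1) powi (- m - 2)) (- n - 2)"
proof -
  have *: "fls_nth ((lie p ^^ k) (fls_X_intpow (n + 1))) (m + 1) / fact k =
      fls_nth (fps_nth (flow p 2 (fls_X_intpow (- m - 2))) k) (- n - 2)" for k
    using residue_lie_power[where g = "fls_X_intpow (- m - 2)" and p = p and k = k and f = "fls_X_intpow (n + 1)"]
    by (simp only: fls_X_intpow_residue) (simp add: flow_def fls_divide_fact_nth algebra_simps)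
  obtain N where N: "grow (flow p 2 (fls_X_intpow (- m - 2))) N" by (rule grow_flow_ex)
  have "Sum_any (\<lambda>k. fls_nth ((lie p ^^ k) (fls_X_intpow (n + 1))) (m + 1) / fact k) =
      fls_nth (E 2 (fls_X_intpow (- m - 2))) (- n - 2)"
    by (simp only: * E_def tsum_nth_Sum_any[OF N])
  also have "e\<^sup>2 = fps_to_fls (fps_exp 2)"
    by (simp add: fps_exp_power_mult flip: fps_to_fls_power)
  then have "E 2 (fls_X_intpow (- m - 2)) = fps_to_fls (fps_exp 2) * fps_to_fls (fps_exp 1 - 1) powi (- m - 2)"
    by (simp only: E2 E_X_intpow)
  finally show ?thesis .
qed

text \<open>The same duality turns the accumulated central terms into a coefficient of
  \<open>tsum schw\<close>, which is a constant series.\<close>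

lemma lie_flow_central:
  "Sum_any (\<lambda>k. fls_nth (fls_deriv (fls_deriv (fls_deriv p)) * (lie p ^^ k) (fls_X_intpow (n + 1))) (-1)
     / fact (Suc k)) = (if n = -2 then - (1 / 2) else 0)"
proof -
  have *: "fls_nth (fls_deriv (fls_deriv (fls_deriv p)) * (lie p ^^ k) (fls_X_intpow (n + 1))) (-1)
     / fact (Suc k) = fls_nth (fps_nth schw k) (- n - 2)" for k
    by (simp only: residue_lie_power fls_X_intpow_residue)
       (simp add: schw_def fls_divide_fact_nth algebra_simps del: fact_Suc)
  show ?thesis
    unfolding * tsum_nth_Sum_any[OF grow_schw, symmetric] tsum_schw by simp
qed

end


section \<open>The coefficients \<open>\<alpha>\<close>\<close>

text \<open>The operator iterated in \<open>exp_vf\<close>, over a general ring so that rational and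
  complex coefficients can be compared.\<close>

definition vf_op :: "(nat \<Rightarrow> 'a::comm_ring_1) \<Rightarrow> 'a fps \<Rightarrow> 'a fps" where
  "vf_op a f = fps_X * Abs_fps a * fps_deriv f"

lemma vf_op_nth_0: "fps_nth (vf_op a f) 0 = 0"
  by (simp add: vf_op_def)

lemma vf_op_nth_Suc:
  "fps_nth (vf_op a f) (Suc m) = (\<Sum>i=0..m. a i * (of_nat (Suc (m - i)) * fps_nth f (Suc (m - i))))"
proof -
  have "fps_nth (vf_op a f) (Suc m) = fps_nth (fps_X * (Abs_fps a * fps_deriv f)) (Suc m)"
    by (simp add: vf_op_def mult.assoc)
  also have "\<dots> = fps_nth (Abs_fps a * fps_deriv f) m"
    by (simp only: fps_X_mult_nth) simp
  finally show ?thesis by (simp add: fps_mult_nth)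
qed

text \<open>With \<open>a 0 = 0\<close> each application raises the order by at least one, starting
  from order 1. Hence each coefficient of \<open>exp_vf\<close> is a finite sum.\<close>

lemma vf_op_power_nth_eq_0:
  assumes "a 0 = 0" and "n \<le> k"
  shows "fps_nth ((vf_op a ^^ k) fps_X) n = 0"
  using assms(2)
proof (induction k arbitrary: n)
  case (Suc k)
  show ?case
  proof (cases n)
    case (Suc m)
    have "a i * (of_nat (Suc (m - i)) * fps_nth ((vf_op a ^^ k) fps_X) (Suc (m - i))) = 0" if "i \<le> m" for i
    proof (cases "i = 0")
      case True
      then show ?thesis using assms(1) Suc.IH[of 1] Suc.prems Suc
        by (cases "k = 0") (auto simp: Suc.IH)
    next
      case False
      then show ?thesis using Suc.IH[of "Suc (m - i)"] Suc.prems Suc that by simp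
    qed
    then show ?thesis using Suc by (simp only: funpow.simps comp_def vf_op_nth_Suc) (intro sum.neutral, auto)
  qed (simp add: vf_op_nth_0)
qed simp

lemma exp_vf_nth:
  assumes "a 0 = 0"
  shows "fps_nth (exp_vf a) n = (\<Sum>k\<le>n. fps_nth ((vf_op a ^^ k) fps_X) n / fact k)"
proof -
  have "{k. fps_nth ((vf_op a ^^ k) fps_X) n / fact k \<noteq> 0} \<subseteq> {..n}"
    using vf_op_power_nth_eq_0[of a n] assms by (auto simp: not_le) (meson nle_le)
  then show ?thesis
    unfolding exp_vf_def vf_op_def[abs_def] by (simp add: Sum_any.expand_superset)
qed

lemma vf_op_power_cong:
  assumes "\<And>i. i < n \<Longrightarrow> a i = b i" and "j \<le> n"
  shows "fps_nth ((vf_op a ^^ k) fps_X) j = fps_nth ((vf_op b ^^ k) fps_X) j"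
  using assms(2)
proof (induction k arbitrary: j)
  case (Suc k)
  show ?case
  proof (cases j)
    case (Suc m)
    then show ?thesis using Suc.IH Suc.prems assms(1)
      by (simp only: funpow.simps comp_def vf_op_nth_Suc) (intro sum.cong refl, auto)
  qed (simp add: vf_op_nth_0)
qed simp

text \<open>Only the term with \<open>k = 1\<close> sees \<open>a n\<close>: in a higher term
  \<open>a n\<close> is multiplied by a coefficient of \<open>z\<close> that is already
  zero.\<close>

lemma exp_vf_nth_diff:
  assumes "a 0 = 0" "b 0 = 0" and eq: "\<And>i. i < n \<Longrightarrow> a i = b i" and "n > 0"
  shows "fps_nth (exp_vf a) (Suc n) - fps_nth (exp_vf b) (Suc n) = a n - b n"
proof -
  have 1: "fps_nth ((vf_op c ^^ 1) fps_X) (Suc n) = c n" for c :: "nat \<Rightarrow> rat"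
  proof -
    have "fps_nth ((vf_op c ^^ 1) fps_X) (Suc n) = (\<Sum>i=0..n. if i = n then c n else 0)"
      by (simp only: funpow.simps comp_def vf_op_nth_Suc One_nat_def) (intro sum.cong refl, auto)
    then show ?thesis by simp
  qed
  have ne1: "fps_nth ((vf_op a ^^ k) fps_X) (Suc n) = fps_nth ((vf_op b ^^ k) fps_X) (Suc n)" if "k \<noteq> 1" for k
  proof (cases k)
    case (Suc l)
    then have l: "l > 0" using that by simp
    have "a i * (of_nat (Suc (n - i)) * fps_nth ((vf_op a ^^ l) fps_X) (Suc (n - i))) =
          b i * (of_nat (Suc (n - i)) * fps_nth ((vf_op b ^^ l) fps_X) (Suc (n - i)))"
      if i: "i \<le> n" for i
    proof -
      consider "i = 0" | "i = n" | "0 < i" "i < n" using i by linarith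
      then show ?thesis
      proof cases
        case 2
        have "fps_nth ((vf_op c ^^ l) fps_X) (Suc 0) = 0" if "c 0 = 0" for c :: "nat \<Rightarrow> rat"
          using vf_op_power_nth_eq_0[of c "Suc 0" l] that l by simp
        then show ?thesis using 2 assms(1,2) by simp
      next
        case 3
        then show ?thesis using eq vf_op_power_cong[of n a b "Suc (n - i)" l] by simp
      qed (use assms in simp)
    qed
    then show ?thesis using Suc
      by (simp only: funpow.simps comp_def vf_op_nth_Suc) (intro sum.cong refl, auto)
  qed simp
  have "fps_nth (exp_vf a) (Suc n) - fps_nth (exp_vf b) (Suc n) =
      (\<Sum>k\<le>Suc n. fps_nth ((vf_op a ^^ k) fps_X) (Suc n) / fact k - fps_nth ((vf_op b ^^ k) fps_X) (Suc n) / fact k)"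
    by (simp only: exp_vf_nth assms(1,2) sum_subtractf)
  also have "\<dots> = (\<Sum>k\<le>Suc n. if k = 1 then a n - b n else 0)"
    by (intro sum.cong refl) (metis 1 ne1 diff_self div_by_1 fact_1)
  finally show ?thesis by simp
qed

text \<open>By \<open>exp_vf_nth_diff\<close>, coefficient \<open>n + 1\<close> of \<open>exp_vf a\<close> is \<open>a n\<close> plus an expression in the
  \<open>a i\<close> with \<open>i < n\<close>.\<close>

fun vf_log :: "(nat \<Rightarrow> rat) \<Rightarrow> nat \<Rightarrow> rat" where
  "vf_log c n = (if n = 0 then 0
     else c (Suc n) - fps_nth (exp_vf (\<lambda>i. if i < n then vf_log c i else 0)) (Suc n))"

declare vf_log.simps [simp del]

lemma exp_vf_vf_log:
  "n > 0 \<Longrightarrow> fps_nth (exp_vf (vf_log c)) (Suc n) = c (Suc n)"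
  using exp_vf_nth_diff[of "vf_log c" "\<lambda>i. if i < n then vf_log c i else 0" n]
  by (simp add: vf_log.simps[of c 0]) (simp add: vf_log.simps[of c n])

lemma exp_vf_nth_low:
  assumes "a 0 = 0"
  shows "fps_nth (exp_vf a) 0 = 0" and "fps_nth (exp_vf a) (Suc 0) = 1"
  using vf_op_power_nth_eq_0[of a 1 1] assms by (simp_all add: exp_vf_nth[of a, OF assms])

text \<open>The definite description in \<open>alpha\<close> is justified by \<open>vf_log\<close>
  for existence and by strong induction with \<open>exp_vf_nth_diff\<close> for uniqueness.\<close>

lemma alpha: "alpha 0 = 0" "exp_vf alpha = fps_exp 1 - 1"
proof -
  have "\<exists>!a. a 0 = 0 \<and> exp_vf a = fps_exp 1 - 1"
  proof (rule ex_ex1I)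
    define c where "c n = fps_nth (fps_exp 1 - 1 :: rat fps) n" for n
    let ?a = "vf_log c"
    have a0: "?a 0 = 0" by (simp add: vf_log.simps)
    have "exp_vf ?a = fps_exp 1 - 1"
    proof (rule fps_ext)
      fix n
      consider "n = 0" | "n = Suc 0" | m where "n = Suc m" "m > 0" by (metis gr0I not0_implies_Suc)
      then show "fps_nth (exp_vf ?a) n = fps_nth (fps_exp 1 - 1) n"
        by cases (simp_all add: exp_vf_nth_low[of ?a, OF a0] exp_vf_vf_log c_def)
    qed
    with a0 show "\<exists>a. a 0 = 0 \<and> exp_vf a = fps_exp 1 - 1" by blast
  next
    fix a b :: "nat \<Rightarrow> rat"
    assume a: "a 0 = 0 \<and> exp_vf a = fps_exp 1 - 1" and b: "b 0 = 0 \<and> exp_vf b = fps_exp 1 - 1"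
    have "a n = b n" for n
    proof (induction n rule: less_induct)
      case (less n)
      then show ?case using a b exp_vf_nth_diff[of a b n] by (cases "n = 0") auto
    qed
    then show "a = b" by auto
  qed
  then have "alpha 0 = 0 \<and> exp_vf alpha = fps_exp 1 - 1"
    unfolding alpha_def by (rule theI')
  then show "alpha 0 = 0" "exp_vf alpha = fps_exp 1 - 1" by auto
qed

lemma vf_op_of_rat:
  assumes "\<And>n. fps_nth g n = (of_rat (fps_nth f n) :: 'a::field_char_0)"
  shows "fps_nth (vf_op (\<lambda>i. of_rat (a i)) g) n = of_rat (fps_nth (vf_op a f) n)"
  by (cases n) (simp_all add: vf_op_nth_0 vf_op_nth_Suc assms of_rat_sum of_rat_mult del: of_nat_Suc of_nat_diff)

lemma of_rat_fact: "of_rat (fact n) = (fact n :: 'a::field_char_0)"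
  by (metis of_nat_fact of_rat_of_nat_eq)

lemma vf_op_power_of_rat:
  "fps_nth ((vf_op (\<lambda>i. of_rat (a i)) ^^ k) fps_X) n =
    (of_rat (fps_nth ((vf_op a ^^ k) fps_X) n) :: 'a::field_char_0)"
proof (induction k arbitrary: n)
  case (Suc k)
  then show ?case by (simp add: vf_op_of_rat)
qed simp

definition alpha_vf :: "'a::field_char_0 fls" where
  "alpha_vf = fps_to_fls (fps_X * Abs_fps (\<lambda>i. of_rat (alpha i)))"

lemma alpha_vf_nth: "fls_nth alpha_vf n = (if n < 1 then 0 else of_rat (alpha (nat (n - 1))))"
  by (auto simp: alpha_vf_def nat_diff_distrib)

lemma tvec_alpha_vf_power:
  "(tvec alpha_vf 0 ^^ k) fls_X = fps_to_fls ((vf_op (\<lambda>i. of_rat (alpha i)) ^^ k) fps_X)"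
proof (induction k)
  case (Suc k)
  have "tvec alpha_vf 0 (fps_to_fls f) = fps_to_fls (vf_op (\<lambda>i. of_rat (alpha i)) f)" for f :: "'a fps"
    by (simp add: tvec_def alpha_vf_def vf_op_def fls_deriv_fps_to_fls fls_times_fps_to_fls)
  then show ?case using Suc by simp
qed simp

text \<open>On power series \<open>tvec alpha_vf 0\<close> is \<open>vf_op\<close>, so setting
  \<open>t = 1\<close> sums the same finitely many terms as the rational identity
  \<open>alpha\<close>.\<close>

lemma exp_flow_alpha: "exp_flow (alpha_vf :: 'a::field_char_0 fls)"
proof
  show p: "fls_nth (alpha_vf :: 'a fls) n = 0" if "n < 2" for n
    using that alpha(1) by (auto simp: alpha_vf_nth)
  have g: "grow (flow (alpha_vf :: 'a fls) 0 fls_X) 1"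
    by (rule grow_flow) (use p in auto)
  show "tsum (flow alpha_vf 0 fls_X) = (fps_to_fls (fps_exp 1 - 1) :: 'a fls)"
  proof (rule fls_eqI)
    fix m :: int
    show "fls_nth (tsum (flow alpha_vf 0 fls_X)) m = fls_nth (fps_to_fls (fps_exp 1 - 1) :: 'a fls) m"
    proof (cases "m < 0")
      case False
      then obtain n where n: "m = int n" using nonneg_int_cases by (metis not_less)
      have K: "m < 1 + int (Suc n)" using n by simp
      have "fls_nth (tsum (flow alpha_vf 0 fls_X)) m =
         (\<Sum>k<Suc n. of_rat (fps_nth ((vf_op alpha ^^ k) fps_X) n / fact k) :: 'a)"
        unfolding tsum_nth[OF g K] 
        by (intro sum.cong refl)
          (simp add: flow_def fls_divide_fact_nth tvec_alpha_vf_power vf_op_power_of_rat n of_rat_divide of_rat_fact)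
      also have "\<dots> = of_rat (fps_nth (exp_vf alpha) n)"
        by (simp only: exp_vf_nth[of alpha, OF alpha(1)] of_rat_sum lessThan_Suc_atMost)
      also have "\<dots> = fls_nth (fps_to_fls (fps_exp 1 - 1)) m"
        by (simp add: alpha(2) n of_rat_diff of_rat_divide of_rat_fact)
      finally show ?thesis .
    qed (use tsum_nth_eq_0[OF g] in simp)
  qed
qed

section \<open>Weight decompositions\<close>

lemma Sum_any_hom:
  assumes "\<And>x y. f (x + y) = f x + f y" and "f 0 = 0" and "finite {k. g k \<noteq> 0}"
  shows "f (Sum_any g) = Sum_any (\<lambda>k. f (g k))"
proof -
  have "f (sum g A) = (\<Sum>k\<in>A. f (g k))" if "finite A" for A
    using that by induction (simp_all add: assms(1,2))
  moreover have "{k. f (g k) \<noteq> 0} \<subseteq> {k. g k \<noteq> 0}" using assms(2) by auto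
  ultimately show ?thesis
    using assms(3) by (simp add: Sum_any.expand_superset[of "{k. g k \<noteq> 0}"])
qed

lemma linear_Sum_any:
  assumes "Vector_Spaces.linear s1 s2 f" and "finite {k. g k \<noteq> 0}"
  shows "f (Sum_any g) = Sum_any (\<lambda>k. f (g k))"
proof -
  interpret Vector_Spaces.linear s1 s2 f by fact
  show ?thesis by (rule Sum_any_hom) (auto simp: add assms(2))
qed

lemma Sum_any_delta_eq:
  assumes "\<And>k. k \<noteq> n \<Longrightarrow> g k = 0"
  shows "Sum_any g = g n"
  using Sum_any.expand_superset[of "{n}" g] assms by auto

lemma Sum_any_int_nat:
  fixes g :: "int \<Rightarrow> 'b::comm_monoid_add"
  assumes "\<And>m. m < 0 \<Longrightarrow> g m = 0"
  shows "Sum_any g = Sum_any (\<lambda>i::nat. g (int i))"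
proof -
  have eq: "{m. g m \<noteq> 0} = int ` {i. g (int i) \<noteq> 0}"
    using assms by (auto simp: image_iff) (metis int_nat_eq not_less)
  show ?thesis
    unfolding Sum_any.expand_set eq by (simp add: sum.reindex)
qed

text \<open>Just the data behind weight decompositions, so that the locale can be interpreted for
  \<open>sq V\<close> as well as for \<open>V\<close>.\<close>

locale graded_voa = vector_space "vscale V" for V :: "'a::ab_group_add voa" +
  assumes lin_L0: "Vector_Spaces.linear (vscale V) (vscale V) (Lm V 0)"
    and grading: "span (\<Union>n. wsp V n) = UNIV"
begin

abbreviation scl :: "complex \<Rightarrow> 'a \<Rightarrow> 'a" (infixr "\<odot>" 75) where "scl \<equiv> vscale V"
abbreviation lin :: "('a \<Rightarrow> 'a) \<Rightarrow> bool" where "lin \<equiv> Vector_Spaces.linear (vscale V) (vscale V)"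

lemma linI: "(\<And>x y. f (x + y) = f x + f y) \<Longrightarrow> (\<And>c x. f (c \<odot> x) = c \<odot> f x) \<Longrightarrow> lin f"
  using vector_space_axioms by (simp add: Vector_Spaces.linear_iff)

lemma lin_add: "lin f \<Longrightarrow> f (x + y) = f x + f y"
  and lin_scale: "lin f \<Longrightarrow> f (c \<odot> x) = c \<odot> f x"
  by (simp_all add: Vector_Spaces.linear_iff)

lemma lin_zero: "lin f \<Longrightarrow> f 0 = 0"
  using lin_scale[of f 0 0] by simp

lemma lin_sum: "lin f \<Longrightarrow> f (sum g A) = (\<Sum>x\<in>A. f (g x))"
  by (induction A rule: infinite_finite_induct) (simp_all add: lin_zero lin_add)

lemma lin_diff: "lin f \<Longrightarrow> f (x - y) = f x - f y"
  by (metis add_diff_cancel_right' diff_add_cancel lin_add)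

lemma lin_comp: "lin f \<Longrightarrow> lin g \<Longrightarrow> lin (\<lambda>x. f (g x))"
  by (simp add: Vector_Spaces.linear_iff)

lemma lin_power: "lin f \<Longrightarrow> lin (f ^^ k)"
  by (induction k) (simp_all add: Vector_Spaces.linear_iff)

lemma lin_Sum_any_pointwise:
  assumes "\<And>k. lin (f k)" and fin: "\<And>x. finite {k. f k x \<noteq> 0}"
  shows "lin (\<lambda>x. Sum_any (\<lambda>k. f k x))"
proof (rule linI)
  show "Sum_any (\<lambda>k. f k (x + y)) = Sum_any (\<lambda>k. f k x) + Sum_any (\<lambda>k. f k y)" for x y
    using Sum_any.distrib[OF fin fin, of x y] by (simp add: lin_add assms(1))
  show "Sum_any (\<lambda>k. f k (c \<odot> x)) = c \<odot> Sum_any (\<lambda>k. f k x)" for c x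
    using Sum_any_hom[OF _ _ fin, of "scl c" x] by (simp add: lin_scale assms(1) scale_right_distrib)
qed

lemma subspace_eigsp: "subspace (eigsp V c)"
  by (rule subspaceI)
     (simp_all add: eigsp_def lin_zero[OF lin_L0] lin_add[OF lin_L0] lin_scale[OF lin_L0]
        scale_right_distrib mult.commute)

lemma subspace_wsp: "subspace (wsp V n)"
  unfolding wsp_def by (rule subspace_eigsp)

text \<open>Applying \<open>L\<^sub>0 - a\<close> removes the term of eigenvalue \<open>a\<close>
  and rescales the others by nonzero factors.\<close>

lemma eigsp_independent:
  assumes "finite A" and "\<And>c. c \<in> A \<Longrightarrow> f c \<in> eigsp V c" and "sum f A = 0" and "c \<in> A"
  shows "f c = 0"
  using assms
proof (induction A arbitrary: f c)
  case (insert a A)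
  have f: "f c \<in> eigsp V c" if "c \<in> insert a A" for c using insert.prems that by blast
  have "Lm V 0 (f a + sum f A) - a \<odot> (f a + sum f A) = 0"
    using insert by (simp add: lin_zero[OF lin_L0])
  moreover have "Lm V 0 (sum f A) = (\<Sum>c\<in>A. c \<odot> f c)"
    using f by (simp add: lin_sum[OF lin_L0] eigsp_def)
  moreover have "Lm V 0 (f a) = a \<odot> f a" using f by (simp add: eigsp_def)
  ultimately have "(\<Sum>c\<in>A. (c - a) \<odot> f c) = 0"
    by (simp add: lin_add[OF lin_L0] scale_right_distrib scale_left_diff_distrib sum_subtractf scale_sum_right)
  moreover have "(c - a) \<odot> f c \<in> eigsp V c" if "c \<in> A" for c
    using f that by (simp add: subspace_scale[OF subspace_eigsp])
  ultimately have "(c - a) \<odot> f c = 0" if "c \<in> A" for c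
    using insert.IH[of "\<lambda>c. (c - a) \<odot> f c"] that by blast
  then have 0: "f c = 0" if "c \<in> A" for c
    using that insert.hyps(2) by auto
  then have "f a = 0" using insert.prems(2) insert.hyps by simp
  then show ?case using 0 insert.prems(3) by blast
qed simp

definition decomp :: "'a \<Rightarrow> (int \<Rightarrow> 'a) \<Rightarrow> bool" where
  "decomp u f \<longleftrightarrow> finite {k. f k \<noteq> 0} \<and> (\<forall>k. f k \<in> wsp V k) \<and> Sum_any f = u"

lemma decomp_0: "decomp 0 (\<lambda>_. 0)"
  by (simp add: decomp_def subspace_0[OF subspace_wsp])

lemma decomp_add:
  assumes "decomp u f" and "decomp v g" shows "decomp (u + v) (\<lambda>k. f k + g k)"
proof -
  have "{k. f k + g k \<noteq> 0} \<subseteq> {k. f k \<noteq> 0} \<union> {k. g k \<noteq> 0}" by auto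
  then show ?thesis
    using assms subspace_add[OF subspace_wsp] unfolding decomp_def
    by (auto simp: Sum_any.distrib intro: finite_subset)
qed

lemma decomp_scale:
  assumes "decomp u f" shows "decomp (c \<odot> u) (\<lambda>k. c \<odot> f k)"
proof -
  have "{k. c \<odot> f k \<noteq> 0} \<subseteq> {k. f k \<noteq> 0}" by auto
  then show ?thesis
    using assms subspace_scale[OF subspace_wsp] Sum_any_hom[of "scl c" f] unfolding decomp_def
    by (auto simp: scale_right_distrib intro: finite_subset)
qed

lemma decomp_homog: "u \<in> wsp V n \<Longrightarrow> decomp u (\<lambda>k. if k = n then u else 0)"
  using Sum_any_delta_eq[of n "\<lambda>k. if k = n then u else 0"]
  by (auto simp: decomp_def subspace_0[OF subspace_wsp])

lemma decomp_unique:
  assumes "decomp u f" and "decomp u g" shows "f = g"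
proof -
  have "decomp (u + (-1) \<odot> u) (\<lambda>k. f k + (-1) \<odot> g k)"
    by (intro decomp_add decomp_scale assms)
  then have d: "decomp 0 (\<lambda>k. f k - g k)" (is "decomp 0 ?h") by simp
  let ?A = "{k. ?h k \<noteq> 0}"
  have fin: "finite ?A" using d by (simp add: decomp_def)
  \<comment> \<open>Eigenvalues are complex while weights are integers; the floor of the real part
    recovers the weight.\<close>
  have "sum (\<lambda>c. ?h \<lfloor>Re c\<rfloor>) (of_int ` ?A) = sum ?h ?A"
    by (subst sum.reindex) (auto intro: inj_onI)
  also have "\<dots> = 0" using d by (simp add: decomp_def Sum_any.expand_set)
  finally have "?h \<lfloor>Re (of_int k)\<rfloor> = 0" if "k \<in> ?A" for k
    using that fin d
    by (intro eigsp_independent[of "of_int ` ?A" "\<lambda>c. ?h \<lfloor>Re c\<rfloor>" "of_int k"])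
       (auto simp: decomp_def wsp_def)
  then have "?h k = 0" for k by (cases "k \<in> ?A") auto
  then show ?thesis by auto
qed

lemma decomp_ex: "\<exists>f. decomp u f"
proof -
  have "u \<in> span (\<Union>n. wsp V n)" using grading by simp
  then show ?thesis
  proof (induction rule: span_induct_alt)
    case base then show ?case using decomp_0 by blast
  next
    case (step c x y)
    then show ?case using decomp_add decomp_scale decomp_homog by blast
  qed
qed

lemma decomp_wpart: "decomp u (\<lambda>k. wpart V k u)"
proof -
  have "\<exists>!f. decomp u f" using decomp_ex decomp_unique by blast
  then have "decomp u (THE f. decomp u f)" by (rule theI')
  then show ?thesis unfolding wpart_def decomp_def by simp
qed

lemma wpart_eqI: "decomp u f \<Longrightarrow> wpart V k u = f k"
  using decomp_unique[OF decomp_wpart] by (metis (no_types))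

lemma wpart_in: "wpart V k u \<in> wsp V k"
  and finite_wpart: "finite {k. wpart V k u \<noteq> 0}"
  and Sum_any_wpart: "Sum_any (\<lambda>k. wpart V k u) = u"
  using decomp_wpart[of u] by (auto simp: decomp_def)

lemma lin_wpart: "lin (wpart V k)"
  by (rule linI) (rule wpart_eqI decomp_add decomp_scale decomp_wpart)+

lemma wpart_homog: "u \<in> wsp V n \<Longrightarrow> wpart V k u = (if k = n then u else 0)"
  by (rule wpart_eqI[OF decomp_homog])

lemma lin_eqI:
  assumes "Vector_Spaces.linear (vscale V) s f" and "Vector_Spaces.linear (vscale V) s g"
    and "\<And>k v. v \<in> wsp V k \<Longrightarrow> f v = g v"
  shows "f u = g u"
  using linear_Sum_any[OF assms(1) finite_wpart[of u]] linear_Sum_any[OF assms(2) finite_wpart[of u]]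
    assms(3)[OF wpart_in] by (simp add: Sum_any_wpart)

lemma eigsp_nonint:
  assumes "c \<notin> \<int>" shows "eigsp V c = {0}"
proof -
  have "u = 0" if u: "u \<in> eigsp V c" for u
  proof -
    let ?A = "{k. wpart V k u \<noteq> 0}"
    \<comment> \<open>The relation \<open>u = sum of its weight components\<close>, written as a
      vanishing sum of eigenvectors with distinct eigenvalues.\<close>
    define f where "f d = (if d = c then - u else wpart V \<lfloor>Re d\<rfloor> u)" for d :: complex
    have c: "c \<noteq> of_int k" for k using assms by auto
    have f: "f (of_int k) = wpart V k u" for k using c[of k] by (simp add: f_def)
    have "sum f (of_int ` ?A) = (\<Sum>k\<in>?A. wpart V k u)"
      by (subst sum.reindex) (auto intro!: inj_onI simp: f)
    also have "\<dots> = u" using Sum_any_wpart[of u] by (simp add: Sum_any.expand_set)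
    finally have sum0: "sum f (insert c (of_int ` ?A)) = 0"
      using c finite_wpart[of u] by (subst sum.insert) (auto simp: f_def)
    have f_in: "f d \<in> eigsp V d" if d: "d \<in> insert c (of_int ` ?A)" for d
    proof (cases "d = c")
      case True
      then show ?thesis using subspace_neg[OF subspace_eigsp u] by (simp add: f_def)
    next
      case False
      then obtain k where "d = of_int k" using d by blast
      then show ?thesis using wpart_in[of k u] f by (simp add: wsp_def)
    qed
    have "f c = 0"
      by (rule eigsp_independent[OF _ f_in sum0]) (use finite_wpart[of u] in auto)
    then show ?thesis by (simp add: f_def)
  qed
  then show ?thesis using subspace_0[OF subspace_eigsp] by auto
qed

lemma homog_ext_homog:
  fixes f :: "int \<Rightarrow> 'a \<Rightarrow> 'b::comm_monoid_add"
  assumes "u \<in> wsp V n" and "\<And>k. f k 0 = 0"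
  shows "homog_ext V f u = f n u"
proof -
  have "homog_ext V f u = f n (wpart V n u)"
    unfolding homog_ext_def
    by (rule Sum_any_delta_eq) (simp add: wpart_homog[OF assms(1)] assms(2))
  then show ?thesis by (simp add: wpart_homog[OF assms(1)])
qed

lemma lin_homog_ext:
  assumes "\<And>k. lin (f k)"
  shows "lin (homog_ext V f)"
  unfolding homog_ext_def[abs_def]
proof (rule lin_Sum_any_pointwise)
  show "lin (\<lambda>x. f k (wpart V k x))" for k by (rule lin_comp[OF assms lin_wpart])
  show "finite {k. f k (wpart V k x) \<noteq> 0}" for x
    by (rule finite_subset[OF _ finite_wpart[of x]]) (auto simp: lin_zero[OF assms])
qed

end

section \<open>The Virasoro action of vector fields\<close>

text \<open>The shift \<open>c\<close> absorbs the offset between the mode index \<open>m\<close>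
  and the exponent \<open>m + 1\<close>, and its change under derivatives.\<close>

lemma fls_times_nth_superset:
  fixes F G :: "'a::comm_semiring_0 fls"
  assumes "finite S" and S: "\<And>i. i \<notin> S \<Longrightarrow> fls_nth F (i + c) = 0 \<or> fls_nth G (n - i - c) = 0"
  shows "fls_nth (F * G) n = (\<Sum>i\<in>S. fls_nth F (i + c) * fls_nth G (n - i - c))"
proof -
  obtain N M where N: "\<And>n. n < N \<Longrightarrow> fls_nth F n = 0" and M: "\<And>n. n < M \<Longrightarrow> fls_nth G n = 0"
    using fls_nth_vanishes_belowE by metis
  define t where "t i = fls_nth F (i + c) * fls_nth G (n - i - c)" for i
  have "fls_nth (F * G) n = (\<Sum>i=N..n - M. fls_nth F i * fls_nth G (n - i))"
    by (rule fls_times_nth_bounds[OF N M])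
  also have "\<dots> = (\<Sum>i=N-c..n - M-c. t i)"
    unfolding t_def
    by (rule sum.reindex_bij_witness[where i = "\<lambda>i. i + c" and j = "\<lambda>i. i - c"]) auto
  also have "\<dots> = (\<Sum>i\<in>S. t i)"
  proof (rule sum.mono_neutral_cong)
    show "t i = 0" if "i \<in> S - {N - c..n - M - c}" for i
    proof -
      have "i + c < N \<or> n - i - c < M" using that by auto
      then show ?thesis using N M by (auto simp: t_def)
    qed
    show "t i = 0" if "i \<in> {N - c..n - M - c} - S" for i
      using that S[of i] by (auto simp: t_def)
  qed (use assms(1) in auto)
  finally show ?thesis by (simp add: t_def)
qed

section \<open>Weights of Virasoro modes and absence of negative weights\<close>

locale cft_voa =
  fixes V :: "'a::ab_group_add voa"
  assumes voa: "voa V" and cft: "cft_type V"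
begin

lemma Lm_linear: "Vector_Spaces.linear (vscale V) (vscale V) (Lm V n)"
  using voa by (simp add: voa_def Lm_def[abs_def])

sublocale graded_voa V
  using voa Lm_linear by (intro graded_voa.intro graded_voa_axioms.intro) (simp_all add: voa_def)

abbreviation L where "L \<equiv> Lm V"

lemmas L_add = lin_add[OF Lm_linear] and L_scale = lin_scale[OF Lm_linear]
  and L_zero = lin_zero[OF Lm_linear] and L_sum = lin_sum[OF Lm_linear]

lemma lin_vmode: "lin (vmode V u n)" and lin_vmode_left: "lin (\<lambda>u. vmode V u n v)"
  using voa by (simp_all add: voa_def)

lemma virasoro: "L m (L n w) = L n (L m w) + of_int (m - n) \<odot> L (m + n) w
    + (if m + n = 0 then of_int (m ^ 3 - m) / 12 * ccharge V else 0) \<odot> w"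
proof -
  have "L m (L n w) - L n (L m w) = of_int (m - n) \<odot> L (m + n) w
    + (if m + n = 0 then of_int (m ^ 3 - m) / 12 * ccharge V else 0) \<odot> w"
    using voa unfolding voa_def by blast
  then show ?thesis by (simp add: algebra_simps)
qed

lemma L_vac: "n \<ge> -1 \<Longrightarrow> L n (vac V) = 0"
  and omega_eq: "L (-2) (vac V) = omega V"
  using voa by (simp_all add: voa_def Lm_def)

lemma wspD: "v \<in> wsp V k \<Longrightarrow> L 0 v = of_int k \<odot> v"
  by (simp add: wsp_def eigsp_def)

lemma wspI: "L 0 v = of_int k \<odot> v \<Longrightarrow> v \<in> wsp V k"
  by (simp add: wsp_def eigsp_def)

lemma vac_wsp: "vac V \<in> wsp V 0"
  by (rule wspI) (simp add: L_vac)

lemma omega_wsp: "omega V \<in> wsp V 2"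
  using virasoro[of 0 "-2" "vac V"]
  by (intro wspI) (simp add: L_vac omega_eq L_zero)

lemma L_wsp:
  assumes "v \<in> wsp V k" shows "L n v \<in> wsp V (k - n)"
proof (rule wspI)
  have "L 0 (L n v) = L n (L 0 v) + of_int (- n) \<odot> L n v"
    using virasoro[of 0 n v] by simp
  then show "L 0 (L n v) = of_int (k - n) \<odot> L n v"
    using assms by (simp add: wspD L_scale scale_left_diff_distrib)
qed

text \<open>A lowest weight vector of negative weight would generate, under \<open>L\<^sub>-\<^sub>1\<close>, a nonzero
  weight 0 vector not killed by \<open>L\<^sub>-\<^sub>1\<close>; but the vacuum is killed.\<close>

lemma lowest_weight_vector_zero:
  assumes v: "v \<in> wsp V m" and "m < 0" and low: "L 1 v = 0"
  shows "v = 0"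
proof -
  let ?w = "\<lambda>j. (L (-1) ^^ j) v"
  have w: "?w j \<in> wsp V (m + int j)" for j
  proof (induction j)
    case (Suc j)
    then show ?case using L_wsp[of "?w j" "m + int j" "-1"] by (simp add: algebra_simps)
  qed (use v in simp)
  have L1: "L 1 (?w (Suc j)) = of_int ((int j + 1) * (2 * m + int j)) \<odot> ?w j" for j
  proof (induction j)
    case 0
    then show ?case using virasoro[of 1 "-1" v] v low by (simp add: L_zero wspD)
  next
    case (Suc j)
    have "L 1 (?w (Suc (Suc j))) = L (-1) (L 1 (?w (Suc j))) + 2 \<odot> L 0 (?w (Suc j))"
      using virasoro[of 1 "-1" "?w (Suc j)"] by simp
    also have "\<dots> = (of_int ((int j + 1) * (2 * m + int j)) + 2 * of_int (m + int (Suc j))) \<odot> ?w (Suc j)"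
      unfolding Suc.IH wspD[OF w] L_scale by (simp add: scale_left_distrib scale_right_distrib)
    also have "of_int ((int j + 1) * (2 * m + int j)) + 2 * of_int (m + int (Suc j)) =
        (of_int ((int (Suc j) + 1) * (2 * m + int (Suc j))) :: complex)"
      by (simp add: algebra_simps)
    finally show ?case .
  qed
  have "?w (nat (-m)) \<in> span {vac V}"
    using w[of "nat (-m)"] \<open>m < 0\<close> cft by (simp add: cft_type_def)
  then obtain c where "?w (nat (-m)) = c \<odot> vac V" by (auto simp: span_singleton)
  then have top: "?w (Suc (nat (-m))) = 0" by (simp add: L_scale L_vac)
  \<comment> \<open>The factor in \<open>L1\<close> is nonzero for \<open>j \<le> -m\<close>, since
    then \<open>2 * m + j < 0\<close>. Vanishing therefore descends from the top to
    \<open>?w 0 = v\<close>.\<close>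
  have "?w (Suc (nat (-m)) - i) = 0" if "i \<le> Suc (nat (-m))" for i
    using that
  proof (induction i)
    case (Suc i)
    define j where "j = nat (-m) - i"
    have "Suc (nat (-m)) - i = Suc j" using Suc.prems by (simp add: j_def)
    then have "of_int ((int j + 1) * (2 * m + int j)) \<odot> ?w j = 0"
      using Suc L1[of j] by (simp add: L_zero)
    moreover have "2 * m + int j < 0" using \<open>m < 0\<close> by (simp add: j_def)
    ultimately have "?w j = 0" by (metis less_irrefl mult_eq_0_iff of_int_eq_0_iff of_nat_0_le_iff
          scale_eq_0_iff zless_add1_eq not_less add.commute zle_add1_eq_le)
    then show ?case by (simp add: j_def)
  qed (use top in simp)
  from this[of "Suc (nat (-m))"] show ?thesis by simp
qed

text \<open>Induction upwards from the truncation bound: if weight \<open>n - 1\<close> is empty,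
  then \<open>L\<^sub>1\<close> kills all vectors of weight \<open>n\<close>.\<close>

lemma wsp_neg:
  assumes "n < 0" shows "wsp V n = {0}"
proof -
  obtain N where N: "\<forall>n<N. wsp V n = {0}" using voa by (auto simp: voa_def)
  have "n < 0 \<longrightarrow> n < N + int j \<longrightarrow> wsp V n = {0}" for j n
  proof (induction j arbitrary: n)
    case (Suc j)
    show ?case
    proof (intro impI)
      assume n: "n < 0" "n < N + int (Suc j)"
      have "v = 0" if "v \<in> wsp V n" for v
      proof (rule lowest_weight_vector_zero[OF that n(1)])
        show "L 1 v = 0" using L_wsp[OF that, of 1] Suc.IH[of "n - 1"] n by simp
      qed
      then show "wsp V n = {0}" using subspace_0[OF subspace_wsp] by auto
    qed
  qed (use N in auto)
  from this[of n "nat (n - N + 1)"] assms show ?thesis by simp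
qed

lemma eigsp_trivial:
  assumes "c \<notin> \<nat>" shows "eigsp V c = {0}"
proof (cases "c \<in> \<int>")
  case True
  then obtain n where n: "c = of_int n" by (elim Ints_cases)
  then have "n < 0" using assms by (metis of_int_of_nat_eq of_nat_in_Nats not_less nonneg_int_cases)
  then show ?thesis using wsp_neg n by (simp add: wsp_def)
qed (rule eigsp_nonint)

lemma wpart_L: "wpart V k (L m v) = L m (wpart V (k + m) v)"
proof (rule lin_eqI[OF lin_comp[OF lin_wpart Lm_linear] lin_comp[OF Lm_linear lin_wpart]])
  fix j v assume v: "v \<in> wsp V j"
  show "wpart V k (L m v) = L m (wpart V (k + m) v)"
    by (auto simp: wpart_homog[OF v] wpart_homog[OF L_wsp[OF v]] L_zero)
qed

text \<open>A strict upper bound for the weights occurring in \<open>v\<close>. Since weights are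
  nonnegative, it is the measure that makes sums over lowering operators finite.\<close>

definition below :: "int \<Rightarrow> 'a \<Rightarrow> bool" where
  "below K v \<longleftrightarrow> (\<forall>k\<ge>K. wpart V k v = 0)"

lemma below_ex: obtains K where "below K v"
proof -
  obtain K where K: "\<And>k. wpart V k v \<noteq> 0 \<Longrightarrow> k \<le> K"
    using bdd_above_finite[OF finite_wpart[of v]] by (auto simp: bdd_above_def)
  have "below (K + 1) v"
    unfolding below_def using K by (metis add_le_same_cancel1 dual_order.trans not_one_le_zero)
  then show ?thesis by (rule that)
qed

lemma below_mono: "below K v \<Longrightarrow> K \<le> K' \<Longrightarrow> below K' v"
  by (simp add: below_def)

lemma below_wsp: "v \<in> wsp V k \<Longrightarrow> below (k + 1) v"
  by (simp add: below_def wpart_homog)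

lemma below_zero: 
  assumes "below K v" and "K \<le> 0" shows "v = 0"
proof -
  have "wpart V k v = 0" for k
    using assms wpart_in[of k v] wsp_neg[of k] by (cases "k < 0") (auto simp: below_def)
  then show ?thesis using Sum_any_wpart[of v] by simp
qed

lemma below_add: "below K u \<Longrightarrow> below K v \<Longrightarrow> below K (u + v)"
  and below_scale: "below K u \<Longrightarrow> below K (c \<odot> u)"
  and below_0: "below K 0"
  by (simp_all add: below_def lin_add[OF lin_wpart] lin_scale[OF lin_wpart] lin_zero[OF lin_wpart])

lemma below_sum: "(\<And>x. x \<in> A \<Longrightarrow> below K (f x)) \<Longrightarrow> below K (sum f A)"
  by (induction A rule: infinite_finite_induct) (auto simp: below_0 below_add)

lemma below_L_eq_0: "below K v \<Longrightarrow> K \<le> m \<Longrightarrow> L m v = 0"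
  by (rule below_zero[of "K - m"]) (auto simp: below_def wpart_L L_zero)

text \<open>The vector field \<open>z^(m+1) \<partial>\<^sub>z\<close> acts as \<open>L\<^sub>m\<close>.\<close>

definition psi :: "complex fls \<Rightarrow> 'a \<Rightarrow> 'a" where
  "psi f v = Sum_any (\<lambda>m. fls_nth f (m + 1) \<odot> L m v)"

lemma psi_support:
  assumes "\<And>m. m < N \<Longrightarrow> fls_nth f (m + 1) = 0" and "below K v"
  shows "{m. fls_nth f (m + 1) \<odot> L m v \<noteq> 0} \<subseteq> {N..<K}"
  using assms(1) below_L_eq_0[OF assms(2)] by (auto simp: linorder_not_less) (metis linorder_not_less)+

lemma finite_psi_support: "finite {m. fls_nth f (m + 1) \<odot> L m v \<noteq> 0}"
proof -
  obtain N where "\<And>m. m < N \<Longrightarrow> fls_nth f m = 0" using fls_nth_vanishes_belowE by blast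
  then have "\<And>m. m < N - 1 \<Longrightarrow> fls_nth f (m + 1) = 0" by simp
  moreover obtain K where "below K v" by (rule below_ex)
  ultimately show ?thesis using psi_support by (meson finite_atLeastLessThan_int finite_subset)
qed

lemma psi_sum:
  assumes "\<And>m. m < N \<Longrightarrow> fls_nth f (m + 1) = 0" and "below K v" and "finite A" and "{N..<K} \<subseteq> A"
  shows "psi f v = (\<Sum>m\<in>A. fls_nth f (m + 1) \<odot> L m v)"
  unfolding psi_def using psi_support[OF assms(1,2)] assms(3,4)
  by (intro Sum_any.expand_superset) auto

lemma lin_psi: "lin (psi f)"
  unfolding psi_def[abs_def]
proof (rule lin_Sum_any_pointwise[OF _ finite_psi_support])
  show "lin (\<lambda>v. fls_nth f (m + 1) \<odot> L m v)" for m
    by (rule linI) (simp_all add: L_add L_scale scale_right_distrib mult.commute)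
qed

lemma below_psi:
  assumes "\<And>m. m < N \<Longrightarrow> fls_nth f (m + 1) = 0" and "below K v"
  shows "below (K - N) (psi f v)"
  unfolding below_def
proof (intro allI impI)
  fix k assume k: "K - N \<le> k"
  have "wpart V k (fls_nth f (m + 1) \<odot> L m v) = 0" for m
    using assms k by (cases "m < N") (auto simp: lin_scale[OF lin_wpart] lin_zero[OF lin_wpart] wpart_L below_def L_zero)
  then show "wpart V k (psi f v) = 0"
    unfolding psi_def by (simp add: linear_Sum_any[OF lin_wpart finite_psi_support])
qed

text \<open>By linearity \<open>v\<close> may be taken homogeneous, where all sums are finite. The
  factor \<open>i - j\<close> in the Virasoro relation yields the bracket, and the cubic central
  factor is that of a third derivative.\<close>

lemma psi_commutator:
  "psi f (psi g v) - psi g (psi f v) = psi (fls_deriv f * g - f * fls_deriv g) v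
     + (ccharge V / 12 * fls_nth (fls_deriv (fls_deriv (fls_deriv f)) * g) (-1)) \<odot> v"
    (is "?lhs v = ?rhs v")
proof (rule lin_eqI[where f = ?lhs and g = ?rhs])
  show "lin ?lhs" "lin ?rhs"
    by (auto intro!: linI simp: lin_add[OF lin_psi] lin_scale[OF lin_psi] algebra_simps scale_right_diff_distrib)
next
  fix w v assume v: "v \<in> wsp V w"
  obtain N where N: "\<And>m. m < N \<Longrightarrow> fls_nth f m = 0" "\<And>m. m < N \<Longrightarrow> fls_nth g m = 0"
  proof -
    obtain N1 N2 where "\<And>m. m < N1 \<Longrightarrow> fls_nth f m = 0" "\<And>m. m < N2 \<Longrightarrow> fls_nth g m = 0"
      using fls_nth_vanishes_belowE by metis
    then show ?thesis using that[of "min N1 N2"] by auto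
  qed
  define n0 where "n0 = min (N - 1) 0"
  have f0: "fls_nth f (m + 1) = 0" and g0: "fls_nth g (m + 1) = 0" if "m < n0" for m
    using that N by (auto simp: n0_def)
  \<comment> \<open>A symmetric box: it contains every index that contributes, and with
    \<open>i\<close> also \<open>- i\<close>, which the central term uses.\<close>
  define M where "M = \<bar>w\<bar> - n0"
  define S where "S = {-M..M}"
  have S: "{n0..w - n0} \<subseteq> S" "finite S" "{n0..-n0} \<subseteq> S" "{n0..<w + 1} \<subseteq> S"
    by (auto simp: S_def M_def n0_def)
  have LL0: "L b v = 0" if "b > w" for b
    using below_L_eq_0[OF below_wsp[OF v], of b] that by simp
  have double: "psi f (psi g v) = (\<Sum>j\<in>S. \<Sum>i\<in>S. (fls_nth f (i + 1) * fls_nth g (j + 1)) \<odot> L i (L j v))"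
    if f0: "\<And>m. m < n0 \<Longrightarrow> fls_nth f (m + 1) = 0" and g0: "\<And>m. m < n0 \<Longrightarrow> fls_nth g (m + 1) = 0"
    for f g
  proof -
    have "psi g v = (\<Sum>j\<in>S. fls_nth g (j + 1) \<odot> L j v)"
      by (rule psi_sum[OF g0 below_wsp[OF v] S(2,4)])
    then have "psi f (psi g v) = (\<Sum>j\<in>S. fls_nth g (j + 1) \<odot> psi f (L j v))"
      by (simp add: lin_sum[OF lin_psi] lin_scale[OF lin_psi])
    also have "\<dots> = (\<Sum>j\<in>S. \<Sum>i\<in>S. (fls_nth f (i + 1) * fls_nth g (j + 1)) \<odot> L i (L j v))"
    proof (intro sum.cong refl)
      fix j assume "j \<in> S"
      show "fls_nth g (j + 1) \<odot> psi f (L j v) = (\<Sum>i\<in>S. (fls_nth f (i + 1) * fls_nth g (j + 1)) \<odot> L i (L j v))"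
      proof (cases "j < n0")
        case False
        have "psi f (L j v) = (\<Sum>i\<in>S. fls_nth f (i + 1) \<odot> L i (L j v))"
          by (rule psi_sum[OF f0 below_wsp[OF L_wsp[OF v]] S(2)]) (use False S in auto)
        then show ?thesis by (simp add: scale_sum_right mult.commute)
      qed (simp add: g0)
    qed
    finally show ?thesis .
  qed
  have "?lhs v = (\<Sum>j\<in>S. \<Sum>i\<in>S. (fls_nth f (i + 1) * fls_nth g (j + 1)) \<odot> (L i (L j v) - L j (L i v)))"
  proof -
    have "psi g (psi f v) = (\<Sum>j\<in>S. \<Sum>i\<in>S. (fls_nth f (i + 1) * fls_nth g (j + 1)) \<odot> L j (L i v))"
      using double[of g f, OF g0 f0] sum.swap[of "\<lambda>j i. (fls_nth f (i + 1) * fls_nth g (j + 1)) \<odot> L j (L i v)" S S]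
      by (simp add: mult.commute)
    then show ?thesis
      by (simp add: double[OF f0 g0] scale_right_diff_distrib sum_subtractf)
  qed
  also have "\<dots> = (\<Sum>j\<in>S. \<Sum>i\<in>S. (fls_nth f (i + 1) * fls_nth g (j + 1) * of_int (i - j)) \<odot> L (i + j) v)
     + (\<Sum>j\<in>S. \<Sum>i\<in>S. (fls_nth f (i + 1) * fls_nth g (j + 1) *
         (if i + j = 0 then of_int (i ^ 3 - i) / 12 * ccharge V else 0)) \<odot> v)"
    unfolding sum.distrib[symmetric]
    by (intro sum.cong refl) (subst virasoro, simp add: scale_right_distrib)
  also have "(\<Sum>j\<in>S. \<Sum>i\<in>S. (fls_nth f (i + 1) * fls_nth g (j + 1) *
         (if i + j = 0 then of_int (i ^ 3 - i) / 12 * ccharge V else 0)) \<odot> v)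
     = (ccharge V / 12 * fls_nth (fls_deriv (fls_deriv (fls_deriv f)) * g) (-1)) \<odot> v"
  proof -
    have inner: "(\<Sum>j\<in>S. fls_nth f (i + 1) * fls_nth g (j + 1) *
         (if i + j = 0 then of_int (i ^ 3 - i) / 12 * ccharge V else 0))
       = ccharge V / 12 * (fls_nth f (i + 1) * fls_nth g (- i + 1) * of_int (i ^ 3 - i))" if "i \<in> S" for i
    proof -
      have "- i \<in> S" using that by (auto simp: S_def)
      then have "(\<Sum>j\<in>S. fls_nth f (i + 1) * fls_nth g (j + 1) *
         (if i + j = 0 then of_int (i ^ 3 - i) / 12 * ccharge V else 0))
       = (\<Sum>j\<in>S. if j = - i then ccharge V / 12 * (fls_nth f (i + 1) * fls_nth g (- i + 1) * of_int (i ^ 3 - i)) else 0)"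
        by (intro sum.cong refl) auto
      then show ?thesis using \<open>- i \<in> S\<close> S(2) by simp
    qed
    have "(\<Sum>j\<in>S. \<Sum>i\<in>S. fls_nth f (i + 1) * fls_nth g (j + 1) *
         (if i + j = 0 then of_int (i ^ 3 - i) / 12 * ccharge V else 0))
      = ccharge V / 12 * (\<Sum>i\<in>S. fls_nth f (i + 1) * fls_nth g (- i + 1) * of_int (i ^ 3 - i))"
      by (subst sum.swap) (simp only: sum_distrib_left inner cong: sum.cong)
    also have "(\<Sum>i\<in>S. fls_nth f (i + 1) * fls_nth g (- i + 1) * of_int (i ^ 3 - i)) =
        fls_nth (fls_deriv (fls_deriv (fls_deriv f)) * g) (-1)"
    proof (subst fls_times_nth_superset[where c = "-2", OF S(2)])
      fix i assume "i \<notin> S"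
      then have "i \<notin> {n0..-n0}" using S(3) by blast
      then have "i < n0 \<or> - i < n0" by auto
      then show "fls_nth (fls_deriv (fls_deriv (fls_deriv f))) (i + - 2) = 0 \<or> fls_nth g (- 1 - i - - 2) = 0"
        using f0[of i] g0[of "-i"] by (auto simp: algebra_simps)
    next
      show "(\<Sum>i\<in>S. fls_nth f (i + 1) * fls_nth g (- i + 1) * of_int (i ^ 3 - i)) =
        (\<Sum>i\<in>S. fls_nth (fls_deriv (fls_deriv (fls_deriv f))) (i + - 2) * fls_nth g (- 1 - i - - 2))"
        by (intro sum.cong refl) (simp add: algebra_simps power3_eq_cube)
    qed
    finally show ?thesis by (simp flip: scale_sum_left)
  qed
  also have "(\<Sum>j\<in>S. \<Sum>i\<in>S. (fls_nth f (i + 1) * fls_nth g (j + 1) * of_int (i - j)) \<odot> L (i + j) v)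
     = psi (fls_deriv f * g - f * fls_deriv g) v"
  proof -
    let ?h = "fls_deriv f * g - f * fls_deriv g"
    have h: "fls_nth ?h (k + 1) = (\<Sum>i\<in>S. fls_nth f (i + 1) * fls_nth g (k - i + 1) * of_int (2 * i - k))"
      if "k \<le> w" for k
    proof -
      have z: "fls_nth f (i + 1) = 0 \<or> fls_nth g (k - i + 1) = 0" if "i \<notin> S" for i
      proof -
        have "i \<notin> {n0..w - n0}" using that S(1) by blast
        then have "i < n0 \<or> k - i < n0" using \<open>k \<le> w\<close> by auto
        then show ?thesis using f0 g0 by auto
      qed
      have "fls_nth (fls_deriv f * g) (k + 1) = (\<Sum>i\<in>S. fls_nth (fls_deriv f) (i + 0) * fls_nth g (k + 1 - i - 0))"
      proof (rule fls_times_nth_superset[OF S(2)])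
        fix i assume "i \<notin> S"
        then show "fls_nth (fls_deriv f) (i + 0) = 0 \<or> fls_nth g (k + 1 - i - 0) = 0"
          using z[of i] by (auto simp: add_diff_eq add.commute diff_add_eq)
      qed
      moreover have "fls_nth (f * fls_deriv g) (k + 1) = (\<Sum>i\<in>S. fls_nth f (i + 1) * fls_nth (fls_deriv g) (k + 1 - i - 1))"
      proof (rule fls_times_nth_superset[OF S(2)])
        fix i assume "i \<notin> S"
        then show "fls_nth f (i + 1) = 0 \<or> fls_nth (fls_deriv g) (k + 1 - i - 1) = 0"
          using z[of i] by auto
      qed
      ultimately show ?thesis
        by (simp add: sum_subtractf[symmetric]) (intro sum.cong refl, simp add: algebra_simps)
    qed
    have h0: "fls_nth ?h (k + 1) = 0" if "k < 2 * n0" for k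
    proof -
      have f1: "fls_nth f m = 0" and g1: "fls_nth g m = 0" if "m < n0 + 1" for m
        using f0[of "m - 1"] g0[of "m - 1"] that by simp_all
      have "fls_nth (fls_deriv f * g) (k + 1) = 0"
        using \<open>k < 2 * n0\<close> f0 g1 by (subst fls_times_nth_bounds[where N = n0 and M = "n0 + 1"]) auto
      moreover have "fls_nth (f * fls_deriv g) (k + 1) = 0"
        using \<open>k < 2 * n0\<close> g0 f1 by (subst fls_times_nth_bounds[where N = "n0 + 1" and M = n0]) auto
      ultimately show ?thesis by simp
    qed
    \<comment> \<open>A range for the total index \<open>k = i + j\<close>; for fixed
      \<open>i\<close>, translation by \<open>i\<close> afterwards leads back to sums over
      \<open>j\<close>.\<close>
    define S2 where "S2 = {-2*M..w}"
    have "psi ?h v = (\<Sum>k\<in>S2. fls_nth ?h (k + 1) \<odot> L k v)"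
      by (rule psi_sum[OF h0 below_wsp[OF v]]) (auto simp: S2_def M_def)
    also have "\<dots> = (\<Sum>k\<in>S2. \<Sum>i\<in>S. (fls_nth f (i + 1) * fls_nth g (k - i + 1) * of_int (2 * i - k)) \<odot> L k v)"
      by (intro sum.cong refl) (subst h, auto simp: S2_def scale_sum_left)
    also have "\<dots> = (\<Sum>i\<in>S. \<Sum>k\<in>S2. (fls_nth f (i + 1) * fls_nth g (k - i + 1) * of_int (2 * i - k)) \<odot> L k v)"
      by (rule sum.swap)
    also have "\<dots> = (\<Sum>i\<in>S. \<Sum>j\<in>S. (fls_nth f (i + 1) * fls_nth g (j + 1) * of_int (i - j)) \<odot> L (i + j) v)"
    proof (rule sum.cong[OF refl])
      fix i assume i: "i \<in> S"
      let ?t = "\<lambda>k. (fls_nth f (i + 1) * fls_nth g (k - i + 1) * of_int (2 * i - k)) \<odot> L k v"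
      have nz: "n0 \<le> i \<and> n0 \<le> k - i \<and> k \<le> w" if "?t k \<noteq> 0" for k
      proof (rule ccontr)
        assume "\<not> ?thesis"
        then consider "i < n0" | "k - i < n0" | "w < k" by linarith
        then show False using that f0[of i] g0[of "k - i"] LL0[of k] by cases auto
      qed
      have "{k. ?t k \<noteq> 0} \<subseteq> S2"
      proof
        fix k assume "k \<in> {k. ?t k \<noteq> 0}"
        then have "n0 \<le> i" "n0 \<le> k - i" "k \<le> w" using nz[of k] by auto
        then show "k \<in> S2" by (simp add: S2_def M_def)
      qed
      then have "(\<Sum>k\<in>S2. ?t k) = Sum_any ?t"
        by (intro Sum_any.expand_superset[symmetric]) (simp_all add: S2_def)
      also have "\<dots> = Sum_any (?t \<circ> (\<lambda>j. i + j))"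
        by (rule Sum_any.reindex_cong[OF _ refl]) (rule bij_betwI[where g = "\<lambda>k. k - i"]; simp)
      also have "\<dots> = (\<Sum>j\<in>S. (?t \<circ> (\<lambda>j. i + j)) j)"
      proof (rule Sum_any.expand_superset[OF S(2)])
        show "{a. (?t \<circ> (+) i) a \<noteq> 0} \<subseteq> S"
        proof
          fix j assume "j \<in> {a. (?t \<circ> (+) i) a \<noteq> 0}"
          then have "n0 \<le> i" "n0 \<le> j" "i + j \<le> w" using nz[of "i + j"] by auto
          then have "j \<in> {n0..w - n0}" by simp
          then show "j \<in> S" using S(1) by blast
        qed
      qed
      also have "(?t \<circ> (\<lambda>j. i + j)) = (\<lambda>j. (fls_nth f (i + 1) * fls_nth g (j + 1) * of_int (i - j)) \<odot> L (i + j) v)"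
      proof
        fix j
        have "2 * i - (i + j) = i - j" "i + j - i + 1 = j + 1" by simp_all
        then show "(?t \<circ> (\<lambda>j. i + j)) j = (fls_nth f (i + 1) * fls_nth g (j + 1) * of_int (i - j)) \<odot> L (i + j) v"
          by (simp only: comp_def)
      qed
      finally show "(\<Sum>k\<in>S2. ?t k) = (\<Sum>j\<in>S. (fls_nth f (i + 1) * fls_nth g (j + 1) * of_int (i - j)) \<odot> L (i + j) v)" .
    qed
    finally show ?thesis by (subst sum.swap) simp
  qed
  finally show "?lhs v = ?rhs v" .
qed

end

section \<open>Conjugation by \<open>T\<close>\<close>

context cft_voa
begin

abbreviation A where "A \<equiv> psi alpha_vf"
abbreviation T where "T \<equiv> T_op V"

lemma alpha_vf_low: "n < 2 \<Longrightarrow> fls_nth alpha_vf n = (0 :: complex)"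
  using exp_flow_alpha exp_flow.p by blast

lemma A_eq: "Sum_any (\<lambda>i. of_rat (alpha i) \<odot> L (int i) x) = A x"
proof -
  have "A x = Sum_any (\<lambda>i. fls_nth alpha_vf (int i + 1) \<odot> L (int i) x)"
    unfolding psi_def by (rule Sum_any_int_nat) (simp add: alpha_vf_nth)
  then show ?thesis by (simp add: alpha_vf_nth)
qed

lemma T_eq: "T v = Sum_any (\<lambda>k. (1 / fact k) \<odot> (A ^^ k) v)"
  unfolding T_op_def by (simp only: A_eq)

lemma lin_A_power: "lin (A ^^ k)"
  by (rule lin_power[OF lin_psi])

text \<open>As \<open>alpha_vf\<close> starts at \<open>z^2\<close>, the operator \<open>A\<close>
  lowers weights by at least one; so \<open>T\<close> is a finite sum on each vector.\<close>

lemma below_A_power: "below K v \<Longrightarrow> below (K - int k) ((A ^^ k) v)"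
proof (induction k)
  case (Suc k)
  have "below (K - int k - 1) (A ((A ^^ k) v))"
    by (rule below_psi[OF _ Suc.IH[OF Suc.prems]]) (simp add: alpha_vf_low)
  then show ?case by (simp add: algebra_simps)
qed simp

lemma A_power_eq_0: "below K v \<Longrightarrow> K \<le> int k \<Longrightarrow> (A ^^ k) v = 0"
  by (rule below_zero[OF below_A_power]) simp_all

lemma T_support:
  assumes "below K v" and "K \<le> int J"
  shows "{k. (1 / fact k) \<odot> (A ^^ k) v \<noteq> 0} \<subseteq> {..<J}"
proof
  fix k assume "k \<in> {k. (1 / fact k) \<odot> (A ^^ k) v \<noteq> 0}"
  then have "\<not> K \<le> int k" using A_power_eq_0[OF assms(1)] by auto
  then show "k \<in> {..<J}" using assms(2) by simp
qed

lemma finite_T_support: "finite {k. (1 / fact k) \<odot> (A ^^ k) v \<noteq> 0}"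
proof -
  obtain K where K: "below K v" by (rule below_ex)
  show ?thesis by (rule finite_subset[OF T_support[OF K, of "nat K"]]) auto
qed

lemma T_sum:
  assumes "below K v" and "K \<le> int J"
  shows "T v = (\<Sum>k<J. (1 / fact k) \<odot> (A ^^ k) v)"
  unfolding T_eq using T_support[OF assms] by (rule Sum_any.expand_superset[OF finite_lessThan])

lemma lin_T: "lin T"
  unfolding T_eq[abs_def]
proof (rule lin_Sum_any_pointwise[OF _ finite_T_support])
  show "lin (\<lambda>v. (1 / fact k) \<odot> (A ^^ k) v)" for k
    by (rule linI) (simp_all add: lin_add[OF lin_A_power] lin_scale[OF lin_A_power] scale_right_distrib mult.commute)
qed

lemma below_T: "below K v \<Longrightarrow> below K (T v)"
proof -
  assume v: "below K v"
  have "below K ((1 / fact k) \<odot> (A ^^ k) v)" for k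
    by (rule below_scale, rule below_mono[OF below_A_power[OF v]]) simp
  then show "below K (T v)"
    using T_sum[OF v, of "nat K"] by (simp add: below_sum)
qed

lemma T_vac: "T (vac V) = vac V"
proof -
  have "A (vac V) = 0"
  proof -
    have "fls_nth alpha_vf (m + 1) \<odot> L m (vac V) = 0" for m
      by (cases "m < 1") (simp_all add: alpha_vf_low L_vac)
    then show ?thesis unfolding psi_def by (simp only: Sum_any.neutral)
  qed
  then have "(A ^^ k) (vac V) = (if k = 0 then vac V else 0)" for k
    by (induction k) (auto simp: lin_zero[OF lin_psi])
  then show ?thesis
    unfolding T_eq by (subst Sum_any_delta_eq[of 0]) auto
qed

text \<open>\<open>T\<close> is unitriangular with respect to weight. Bijectivity follows by
  descending on the weight bound.\<close>

lemma T_minus_id: "below K v \<Longrightarrow> below (K - 1) (T v - v)"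
proof -
  assume v: "below K v"
  have "T v = (\<Sum>k<Suc (nat K). (1 / fact k) \<odot> (A ^^ k) v)" by (rule T_sum[OF v]) simp
  then have eq: "T v - v = (\<Sum>k<nat K. (1 / fact (Suc k)) \<odot> (A ^^ Suc k) v)"
    by (simp add: sum.lessThan_Suc_shift del: sum.lessThan_Suc fact_Suc funpow.simps(2))
  have "below (K - 1) ((A ^^ Suc k) v)" for k
    by (rule below_mono[OF below_A_power[OF v]]) simp
  then show "below (K - 1) (T v - v)"
    unfolding eq by (intro below_sum below_scale)
qed

lemma T_surj: "\<exists>w. T w = v"
proof -
  have "\<exists>w. T w = v" if "below (int K) v" for K v
    using that
  proof (induction K arbitrary: v)
    case 0
    then have "v = 0" using below_zero by simp
    then show ?case using lin_zero[OF lin_T] by blast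
  next
    case (Suc K)
    then have "below (int K) (T v - v)" using T_minus_id[of "int (Suc K)" v] by simp
    then obtain w where "T w = T v - v" using Suc.IH by blast
    then have "T (v - w) = v" by (simp add: lin_diff[OF lin_T])
    then show ?case by blast
  qed
  moreover obtain K where "below K v" by (rule below_ex)
  then have "below (int (nat K)) v" by (rule below_mono) simp
  ultimately show ?thesis by blast
qed

lemma T_inj: "T v = 0 \<Longrightarrow> v = 0"
proof -
  assume T: "T v = 0"
  have neg: "below K (- u)" if "below K u" for K u
    using below_scale[OF that, of "-1"] by simp
  obtain K where K: "below K v" by (rule below_ex)
  have "below (K - int j) v" for j
  proof (induction j)
    case (Suc j)
    then show ?case using neg[OF T_minus_id[OF Suc]] T by (simp add: algebra_simps)
  qed (use K in simp)
  from this[of "nat K"] show "v = 0" by (rule below_zero) simp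
qed

text \<open>The \<open>j\<close>-th iterated commutator of \<open>A\<close> with \<open>psi f\<close>.\<close>

definition ad :: "complex fls \<Rightarrow> nat \<Rightarrow> 'a \<Rightarrow> 'a" where
  "ad f j v = psi ((lie alpha_vf ^^ j) f) v + (if j = 0 then 0 else ccharge V / 12 *
     fls_nth (fls_deriv (fls_deriv (fls_deriv alpha_vf)) * (lie alpha_vf ^^ (j - 1)) f) (-1)) \<odot> v"

lemma lin_ad: "lin (ad f j)"
  by (rule linI) (simp_all add: ad_def lin_add[OF lin_psi] lin_scale[OF lin_psi] scale_right_distrib algebra_simps)

text \<open>The scalar produced by earlier commutators commutes with \<open>A\<close>, so only the
  scalar of the newest commutator enters \<open>ad f (Suc j)\<close>.\<close>

lemma A_ad: "A (ad f j v) = ad f j (A v) + ad f (Suc j) v"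
  using psi_commutator[of alpha_vf "(lie alpha_vf ^^ j) f" v]
  by (simp add: ad_def lin_add[OF lin_psi] lin_scale[OF lin_psi] flip: lie_def)
     (simp add: algebra_simps)

text \<open>The part of degree \<open>k\<close> of
  \<open>exp(A) psi = (exp(ad A) psi) exp(A)\<close>; dividing by factorials absorbs the binomial
  coefficients.\<close>

lemma A_power_psi:
  "(1 / fact k) \<odot> (A ^^ k) (psi f v) =
   (\<Sum>j\<le>k. (1 / fact j) \<odot> ad f j ((1 / fact (k - j)) \<odot> (A ^^ (k - j)) v))"
proof (induction k)
  case 0
  then show ?case by (simp add: ad_def)
next
  case (Suc k)
  define a where "a l = (1 / fact l) \<odot> (A ^^ l) v" for l
  define e where "e j w = (1 / fact j) \<odot> ad f j w" for j w
  have lin_e: "lin (e j)" for j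
    by (rule linI) (simp_all add: e_def lin_add[OF lin_ad] lin_scale[OF lin_ad] scale_right_distrib mult.commute)
  have a: "A (a l) = of_nat (Suc l) \<odot> a (Suc l)" for l
    by (simp add: a_def lin_scale[OF lin_psi] del: of_nat_Suc)
  have e: "A (e j w) = e j (A w) + of_nat (Suc j) \<odot> e (Suc j) w" for j w
    by (simp add: e_def lin_scale[OF lin_psi] A_ad scale_right_distrib del: of_nat_Suc)
  have "of_nat (Suc k) \<odot> ((1 / fact (Suc k)) \<odot> (A ^^ Suc k) (psi f v)) = A ((1 / fact k) \<odot> (A ^^ k) (psi f v))"
    by (simp add: lin_scale[OF lin_psi] del: of_nat_Suc)
  also have "\<dots> = A (\<Sum>j\<le>k. e j (a (k - j)))"
    using Suc.IH by (simp add: e_def a_def)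
  also have "\<dots> = (\<Sum>j\<le>k. of_nat (Suc k - j) \<odot> e j (a (Suc k - j))) + (\<Sum>j\<le>k. of_nat (Suc j) \<odot> e (Suc j) (a (k - j)))"
    unfolding lin_sum[OF lin_psi] e a sum.distrib[symmetric]
    by (intro sum.cong refl) (simp add: lin_scale[OF lin_e] Suc_diff_le del: of_nat_Suc)
  also have "(\<Sum>j\<le>k. of_nat (Suc k - j) \<odot> e j (a (Suc k - j))) = (\<Sum>j\<le>Suc k. of_nat (Suc k - j) \<odot> e j (a (Suc k - j)))"
    by simp
  also have "(\<Sum>j\<le>k. of_nat (Suc j) \<odot> e (Suc j) (a (k - j))) = (\<Sum>j\<le>Suc k. of_nat j \<odot> e j (a (Suc k - j)))"
    by (simp add: sum.atMost_Suc_shift del: sum.atMost_Suc of_nat_Suc)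
  also have "(\<Sum>j\<le>Suc k. of_nat (Suc k - j) \<odot> e j (a (Suc k - j))) + (\<Sum>j\<le>Suc k. of_nat j \<odot> e j (a (Suc k - j)))
     = of_nat (Suc k) \<odot> (\<Sum>j\<le>Suc k. e j (a (Suc k - j)))"
    unfolding sum.distrib[symmetric] scale_sum_right
    by (intro sum.cong refl) (simp add: of_nat_diff flip: scale_left_distrib del: of_nat_Suc)
  finally show ?case
    unfolding e_def a_def by (simp only: scale_cancel_left) (simp del: of_nat_Suc)
qed

text \<open>The explicit form of \<open>L[n]\<close>, confirmed in \<open>Lm_sq\<close>. The scalar
  stems from the vacuum part of the square bracket conformal vector.\<close>

definition sqL :: "int \<Rightarrow> 'a \<Rightarrow> 'a" where
  "sqL n w = Sum_any (\<lambda>m. sq_coeff 2 (m + 1) (n + 1) \<odot> L m w)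
     + (if n = -2 then - (ccharge V / 24) else 0) \<odot> w"

lemma psi_X_intpow: "psi (fls_X_intpow (n + 1)) v = L n v"
  unfolding psi_def by (subst Sum_any_delta_eq[of n]) auto

text \<open>Moving \<open>L\<^sub>n\<close> through \<open>T\<close> applies
  \<open>exp(ad A)\<close> to it. The vector field part is given by \<open>lie_flow_nth\<close>, the
  central part by \<open>lie_flow_central\<close>, with
  \<open>C/12 * (-1/2) = -C/24\<close>.\<close>

lemma T_L: "T (L n v) = sqL n (T v)"
proof -
  let ?p = "alpha_vf :: complex fls"
  let ?p3 = "fls_deriv (fls_deriv (fls_deriv ?p))"
  define f where "f = (fls_X_intpow (n + 1) :: complex fls)"
  let ?D = "\<lambda>j. (lie ?p ^^ j) f"
  have p: "\<And>m. m < 2 \<Longrightarrow> fls_nth ?p m = 0" by (rule alpha_vf_low)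
  have D0: "fls_nth (?D j) m = 0" if "m < n + 1 + int j" for j m
    by (rule lie_power_nth_eq_0[OF p, where M = "n + 1", OF _ _ that]) (auto simp: f_def)
  have R0: "fls_nth (?p3 * ?D j) (-1) = 0" if "int j > - n - 2" for j
  proof -
    have "fls_nth ?p3 m = 0" if "m < 0" for m
      using that p[of "m + 3"] by (cases "m = -1") (auto simp: add.commute)
    then show ?thesis
      using that D0[of _ j] by (subst fls_times_nth_bounds[where N = 0 and M = "n + 1 + int j"]) auto
  qed
  obtain K where K: "below K v" by (rule below_ex)
  obtain K' where K': "below K' (L n v)" by (rule below_ex)
  \<comment> \<open>From \<open>J\<close> commutators on, \<open>ad f j\<close> kills all vectors
    bounded by \<open>K\<close>. If \<open>j + l \<ge> N\<close>, then \<open>l \<ge> K\<close>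
    kills \<open>A^l v\<close> or \<open>j \<ge> J\<close> applies.\<close>
  define J where "J = nat (max (K - n) 0 + \<bar>n\<bar> + 2)"
  have J: "int J \<ge> K - n" "int J \<ge> \<bar>n\<bar> + 2" by (auto simp: J_def)
  define N where "N = J + nat K + nat K' + 1"
  have ad0: "ad f j u = 0" if "below K u" "j \<ge> J" for j u
  proof -
    have "psi (?D j) u = 0"
    proof -
      have "psi (?D j) u = (\<Sum>m\<in>{}. fls_nth (?D j) (m + 1) \<odot> L m u)"
        by (rule psi_sum[OF _ that(1), where N = "n + int j"]) (use D0 \<open>j \<ge> J\<close> J in auto)
      then show ?thesis by simp
    qed
    moreover have "fls_nth (?p3 * ?D (j - 1)) (-1) = 0"
      by (rule R0) (use \<open>j \<ge> J\<close> J in auto)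
    ultimately show ?thesis by (simp add: ad_def)
  qed
  define t where "t j l = (1 / fact j) \<odot> ad f j ((1 / fact l) \<odot> (A ^^ l) v)" for j l
  have t0: "t j l = 0" if "N \<le> j + l" for j l
  proof (cases "K \<le> int l")
    case True
    then show ?thesis using A_power_eq_0[OF K] by (simp add: t_def lin_zero[OF lin_ad])
  next
    case False
    then have "j \<ge> J" using that by (simp add: N_def)
    moreover have "below K ((1 / fact l) \<odot> (A ^^ l) v)"
      by (rule below_scale, rule below_mono[OF below_A_power[OF K]]) simp
    ultimately show ?thesis by (simp add: t_def ad0)
  qed
  have "T (L n v) = (\<Sum>k<N. (1 / fact k) \<odot> (A ^^ k) (psi f v))"
    unfolding f_def psi_X_intpow by (rule T_sum[OF K']) (simp add: N_def)
  also have "\<dots> = (\<Sum>k<N. \<Sum>j\<le>k. t j (k - j))"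
    by (simp only: A_power_psi t_def)
  also have "\<dots> = (\<Sum>(j,l)\<in>{(j,l). j + l < N}. t j l)"
    by (simp add: sum.triangle_reindex)
  also have "\<dots> = (\<Sum>(j,l)\<in>{..<N} \<times> {..<N}. t j l)"
    using t0 by (intro sum.mono_neutral_left) (auto, metis not_le)
  also have "\<dots> = (\<Sum>j<N. \<Sum>l<N. t j l)" by (simp add: sum.cartesian_product)
  also have "\<dots> = (\<Sum>j<N. (1 / fact j) \<odot> ad f j (T v))"
  proof -
    have "T v = (\<Sum>l<N. (1 / fact l) \<odot> (A ^^ l) v)" by (rule T_sum[OF K]) (simp add: N_def)
    then show ?thesis by (simp add: t_def lin_sum[OF lin_ad] scale_sum_right)
  qed
  also have "\<dots> = (\<Sum>j<N. (1 / fact j) \<odot> psi (?D j) (T v)) +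
     (\<Sum>j<N. (1 / fact j) \<odot> ((if j = 0 then 0 else ccharge V / 12 * fls_nth (?p3 * ?D (j - 1)) (-1)) \<odot> T v))"
    by (simp add: ad_def scale_right_distrib sum.distrib)
  also have "(\<Sum>j<N. (1 / fact j) \<odot> ((if j = 0 then 0 else ccharge V / 12 * fls_nth (?p3 * ?D (j - 1)) (-1)) \<odot> T v))
     = (if n = -2 then - (ccharge V / 24) else 0) \<odot> T v"
  proof -
    \<comment> \<open>The term \<open>j = 0\<close> has no central part; shifting the others by one
      produces the factorials \<open>fact (Suc k)\<close> of \<open>schw\<close>.\<close>
    obtain N' where N': "N = Suc N'" "N' = J + nat K + nat K'" by (simp_all add: N_def)
    have supp: "{k. fls_nth (?p3 * ?D k) (-1) / fact (Suc k) \<noteq> 0} \<subseteq> {..<N'}"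
    proof
      fix k assume "k \<in> {k. fls_nth (?p3 * ?D k) (-1) / fact (Suc k) \<noteq> 0}"
      then have "\<not> int k > - n - 2" using R0[of k] by auto
      then show "k \<in> {..<N'}" using N' J(2) by simp
    qed
    have "(\<Sum>j<N. (1 / fact j) \<odot> ((if j = 0 then 0 else ccharge V / 12 * fls_nth (?p3 * ?D (j - 1)) (-1)) \<odot> T v))
       = (\<Sum>k<N'. (ccharge V / 12 * (fls_nth (?p3 * ?D k) (-1) / fact (Suc k))) \<odot> T v)"
      unfolding N'(1) by (simp add: sum.lessThan_Suc_shift del: sum.lessThan_Suc fact_Suc)
    also have "\<dots> = (ccharge V / 12 * (\<Sum>k<N'. fls_nth (?p3 * ?D k) (-1) / fact (Suc k))) \<odot> T v"
      by (simp only: scale_sum_left sum_distrib_left)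
    also have "(\<Sum>k<N'. fls_nth (?p3 * ?D k) (-1) / fact (Suc k)) = (if n = -2 then - (1 / 2) else 0)"
      using exp_flow.lie_flow_central[OF exp_flow_alpha, where n = n and 'a = complex]
      unfolding f_def[symmetric] Sum_any.expand_superset[OF finite_lessThan supp] .
    finally show ?thesis by simp
  qed
  also have "(\<Sum>j<N. (1 / fact j) \<odot> psi (?D j) (T v)) = Sum_any (\<lambda>m. sq_coeff 2 (m + 1) (n + 1) \<odot> L m (T v))"
  proof -
    have c: "(\<Sum>j<N. fls_nth (?D j) (m + 1) / fact j) = sq_coeff 2 (m + 1) (n + 1)" if "m < K" for m
    proof -
      have "{j. fls_nth (?D j) (m + 1) / fact j \<noteq> 0} \<subseteq> {..<N}"
      proof
        fix j assume "j \<in> {j. fls_nth (?D j) (m + 1) / fact j \<noteq> 0}"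
        then have "\<not> m + 1 < n + 1 + int j" using D0 by auto
        then show "j \<in> {..<N}" using that J(1) by (simp add: N_def)
      qed
      then have "(\<Sum>j<N. fls_nth (?D j) (m + 1) / fact j) = Sum_any (\<lambda>j. fls_nth (?D j) (m + 1) / fact j)"
        by (rule Sum_any.expand_superset[OF finite_lessThan, symmetric])
      also have "\<dots> = sq_coeff 2 (m + 1) (n + 1)"
        unfolding f_def exp_flow.lie_flow_nth[OF exp_flow_alpha] sq_coeff_def by (simp add: algebra_simps)
      finally show ?thesis .
    qed
    have bT: "below K (T v)" by (rule below_T[OF K])
    have psi: "psi (?D j) (T v) = (\<Sum>m\<in>{n..<K}. fls_nth (?D j) (m + 1) \<odot> L m (T v))" for j
      by (rule psi_sum[OF _ bT, where N = n]) (use D0 in auto)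
    have low: "sq_coeff 2 (m + 1) (n + 1) = 0" if "m < n" "m < K" for m
      unfolding c[OF that(2), symmetric] using that(1) by (intro sum.neutral ballI) (simp add: D0)
    have "(\<Sum>j<N. (1 / fact j) \<odot> psi (?D j) (T v)) =
       (\<Sum>j<N. \<Sum>m\<in>{n..<K}. (fls_nth (?D j) (m + 1) / fact j) \<odot> L m (T v))"
      unfolding psi by (simp add: scale_sum_right)
    also have "\<dots> = (\<Sum>m\<in>{n..<K}. \<Sum>j<N. (fls_nth (?D j) (m + 1) / fact j) \<odot> L m (T v))"
      by (rule sum.swap)
    also have "\<dots> = (\<Sum>m\<in>{n..<K}. sq_coeff 2 (m + 1) (n + 1) \<odot> L m (T v))"
      by (intro sum.cong refl) (simp add: c flip: scale_sum_left)
    also have "\<dots> = Sum_any (\<lambda>m. sq_coeff 2 (m + 1) (n + 1) \<odot> L m (T v))"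
    proof (rule Sum_any.expand_superset[symmetric])
      show "{m. sq_coeff 2 (m + 1) (n + 1) \<odot> L m (T v) \<noteq> 0} \<subseteq> {n..<K}"
      proof
        fix m assume m: "m \<in> {m. sq_coeff 2 (m + 1) (n + 1) \<odot> L m (T v) \<noteq> 0}"
        then have "m < K" using below_L_eq_0[OF bT, of m] by (auto simp: not_less[symmetric])
        then show "m \<in> {n..<K}" using m low[of m] by (auto simp: not_less[symmetric])
      qed
    qed simp
    finally show ?thesis .
  qed
  finally show ?thesis by (simp add: sqL_def)
qed

end

section \<open>The square bracket structure, traces and the form\<close>

lemma sq_coeff_eq_0:
  assumes "m < n" shows "sq_coeff k m n = 0"
proof -
  have "subdegree (fps_exp 1 - 1 :: complex fps) = 1"
    by (rule subdegreeI) simp_all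
  then have "fls_subdegree (fps_to_fls (fps_exp 1 - 1 :: complex fps)) = 1"
    by (simp only: fls_subdegree_fls_to_fps of_nat_1)
  moreover have "fls_subdegree (fps_to_fls (fps_exp (of_int k) :: complex fps)) = 0"
    by (simp add: fls_subdegree_fls_to_fps)
  ultimately show ?thesis
    unfolding sq_coeff_def using assms by (intro fls_times_nth_eq0) simp
qed

lemma sq_coeff_minus_1: "sq_coeff k (-1) (n + 1) = (if n < -1 then of_int k ^ nat (- 2 - n) / fact (nat (- 2 - n)) else 0)"
  by (auto simp: sq_coeff_def)

text \<open>The map \<open>h\<close> has the pairings with the basis as coordinates. Nondegeneracy
  makes it injective on the finite-dimensional span, hence onto, and the dual vector is the preimage
  of \<open>u\<close>.\<close>

lemma (in vector_space) dual_basis_ex1: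
  assumes B: "finite B" "independent B" and F: "\<And>b. Vector_Spaces.linear scale (*) (F b)"
    and nondeg: "\<And>w. w \<in> span B \<Longrightarrow> (\<And>b. b \<in> B \<Longrightarrow> F b w = 0) \<Longrightarrow> w = 0"
    and u: "u \<in> B"
  shows "\<exists>!w. w \<in> span B \<and> (\<forall>b\<in>B. F b w = (if b = u then 1 else 0))"
proof (rule ex_ex1I)
  have F_add: "F b (x + y) = F b x + F b y" and F_scale: "F b (scale c x) = c * F b x" for b c x y
    using F by (auto simp: Vector_Spaces.linear_iff)
  have F_diff: "F b (x - y) = F b x - F b y" for b x y
    using F_add[of b "x - y" y] by simp
  define h where "h w = (\<Sum>b\<in>B. scale (F b w) b)" for w
  have lin_h: "Vector_Spaces.linear scale scale h"
    using vector_space_axioms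
    by (simp add: Vector_Spaces.linear_iff h_def F_add F_scale scale_left_distrib sum.distrib scale_sum_right)
  have coeff: "F b w = g b" if "h w = (\<Sum>b\<in>B. scale (g b) b)" "b \<in> B" for b w g
  proof -
    have "(\<Sum>b\<in>B. scale (F b w - g b) b) = 0"
      using that(1) by (simp add: h_def scale_left_diff_distrib sum_subtractf)
    from independentD[OF B(2,1) subset_refl this that(2)] show ?thesis by simp
  qed
  interpret h: Vector_Spaces.linear scale scale h by (rule lin_h)
  have inj: "inj_on h (span B)"
  proof (rule inj_onI)
    fix x y assume "x \<in> span B" "y \<in> span B" "h x = h y"
    moreover from this have "F b (x - y) = 0" if "b \<in> B" for b
      using coeff[of "x - y" "\<lambda>_. 0"] that by (simp add: h.diff)
    ultimately show "x = y" using nondeg[of "x - y"] by (simp add: span_diff)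
  qed
  have "h ` B \<subseteq> span B"
    unfolding h_def by (intro image_subsetI span_sum span_scale span_base)
  moreover have indep: "independent (h ` B)"
    by (rule h.independent_injective_image[OF B(2) inj])
  moreover have "card (h ` B) = card B"
    using inj span_superset by (metis card_image inj_on_subset)
  ultimately have "u \<in> span (h ` B)"
  proof -
    assume sub: "h ` B \<subseteq> span B" and card: "card (h ` B) = card B"
    show ?thesis
    proof (rule ccontr)
      assume "u \<notin> span (h ` B)"
      then have "independent (insert u (h ` B))" "u \<notin> h ` B"
        using indep span_base by (auto simp: independent_insert)
      moreover have "insert u (h ` B) \<subseteq> span B" using sub u span_base by auto
      ultimately show False
        using independent_span_bound[OF B(1), of "insert u (h ` B)"] card B(1) by simp
    qed
  qed
  then obtain w where w: "w \<in> span B" "h w = u"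
    unfolding h.span_image by blast
  have "u = (\<Sum>b\<in>B. scale (if b = u then 1 else 0) b)"
  proof -
    have "(\<Sum>b\<in>B. scale (if b = u then 1 else 0) b) = (\<Sum>b\<in>B. if b = u then b else 0)"
      by (intro sum.cong refl) auto
    then show ?thesis using u B(1) by simp
  qed
  then have "\<forall>b\<in>B. F b w = (if b = u then 1 else 0)"
    using coeff[of w "\<lambda>b. if b = u then 1 else 0"] w(2) by simp
  with w(1) show "\<exists>w. w \<in> span B \<and> (\<forall>b\<in>B. F b w = (if b = u then 1 else 0))" by blast
  fix x y
  assume "x \<in> span B \<and> (\<forall>b\<in>B. F b x = (if b = u then 1 else 0))"
    and "y \<in> span B \<and> (\<forall>b\<in>B. F b y = (if b = u then 1 else 0))"
  then show "x = y" using nondeg[of "x - y"] by (simp add: F_diff span_diff)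
qed

lemma sq_simps [simp]:
  "vscale (sq V) = vscale V" "vac (sq V) = vac V" "vmode (sq V) = sq_mode V"
  "omega (sq V) = omega V - vscale V (ccharge V / 24) (vac V)"
  by (simp_all add: sq_def)

section \<open>Virasoro operators of the square bracket structure\<close>

context cft_voa
begin

lemma truncation: obtains N where "\<And>n. n \<ge> N \<Longrightarrow> vmode V u n v = 0"
proof -
  have "\<exists>N. \<forall>n\<ge>N. vmode V u n v = 0" using voa by (simp add: voa_def)
  then show ?thesis using that by blast
qed

lemmas borcherds = voa[unfolded voa_def, THEN conjunct2, THEN conjunct2, THEN conjunct2,
  THEN conjunct2, THEN conjunct2, THEN conjunct2, THEN conjunct1, rule_format]

lemma vmode_vac: "vmode V (vac V) n v = (if n = -1 then v else 0)"
  and creation: "vmode V u (-1) (vac V) = u" "n \<ge> 0 \<Longrightarrow> vmode V u n (vac V) = 0"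
  using voa by (simp_all add: voa_def)

definition sq_homog :: "int \<Rightarrow> 'a \<Rightarrow> int \<Rightarrow> 'a \<Rightarrow> 'a" where
  "sq_homog n w k x = Sum_any (\<lambda>m. sq_coeff k m n \<odot> vmode V x m w)"

lemma sq_mode_eq: "sq_mode V v n w = homog_ext V (sq_homog n w) v"
  by (simp add: sq_mode_def sq_homog_def[abs_def])

lemma lin_sq_homog: "lin (sq_homog n w k)"
  unfolding sq_homog_def[abs_def]
proof (rule lin_Sum_any_pointwise)
  show "lin (\<lambda>x. sq_coeff k m n \<odot> vmode V x m w)" for m
    by (rule linI) (simp_all add: lin_add[OF lin_vmode_left] lin_scale[OF lin_vmode_left] scale_right_distrib mult.commute)
  fix x
  obtain N where N: "\<And>m. m \<ge> N \<Longrightarrow> vmode V x m w = 0" using truncation by blast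
  have "{m. sq_coeff k m n \<odot> vmode V x m w \<noteq> 0} \<subseteq> {n..<N}"
  proof
    fix m assume "m \<in> {m. sq_coeff k m n \<odot> vmode V x m w \<noteq> 0}"
    then have "\<not> m < n" "\<not> m \<ge> N" using sq_coeff_eq_0[of m n k] N[of m] by auto
    then show "m \<in> {n..<N}" by simp
  qed
  then show "finite {m. sq_coeff k m n \<odot> vmode V x m w \<noteq> 0}" by (rule finite_subset) simp
qed

lemma lin_sq_mode: "lin (\<lambda>v. sq_mode V v n w)"
  unfolding sq_mode_eq by (rule lin_homog_ext[OF lin_sq_homog])

lemma sq_mode_homog: "v \<in> wsp V k \<Longrightarrow> sq_mode V v n w = sq_homog n w k v"
  unfolding sq_mode_eq by (rule homog_ext_homog) (simp_all add: lin_zero[OF lin_sq_homog])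

text \<open>The two parts of the conformal vector have weights 2 and 0 and are expanded separately;
  the vacuum part contributes only for \<open>n = -2\<close>.\<close>

lemma Lm_sq: "Lm (sq V) n w = sqL n w"
proof -
  have "sq_homog (n + 1) w 2 (omega V) = Sum_any ((\<lambda>m. sq_coeff 2 m (n + 1) \<odot> vmode V (omega V) m w) \<circ> (\<lambda>m. m + 1))"
    unfolding sq_homog_def
    by (rule Sum_any.reindex_cong[OF _ refl]) (rule bij_betwI[where g = "\<lambda>k. k - 1"]; simp)
  then have 2: "sq_mode V (omega V) (n + 1) w = Sum_any (\<lambda>m. sq_coeff 2 (m + 1) (n + 1) \<odot> L m w)"
    by (simp add: sq_mode_homog[OF omega_wsp] Lm_def comp_def)
  have "sq_homog (n + 1) w 0 (vac V) = sq_coeff 0 (-1) (n + 1) \<odot> w"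
    unfolding sq_homog_def by (subst Sum_any_delta_eq[of "-1"]) (simp_all add: vmode_vac)
  then have 0: "sq_mode V (vac V) (n + 1) w = (if n = -2 then 1 else 0) \<odot> w"
    by (auto simp: sq_mode_homog[OF vac_wsp] sq_coeff_minus_1)
  show ?thesis
    by (auto simp: Lm_def[of "sq V"] lin_diff[OF lin_sq_mode] lin_scale[OF lin_sq_mode] 2 0 sqL_def)
qed

lemma Lm_sq_T: "Lm (sq V) n (T v) = T (L n v)"
  by (simp add: Lm_sq T_L)

lemma T_eq_iff: "T u = T v \<longleftrightarrow> u = v"
  using T_inj[of "u - v"] by (auto simp: lin_diff[OF lin_T])

lemma wsp_sq_T: "T v \<in> wsp (sq V) k \<longleftrightarrow> v \<in> wsp V k"
  by (simp add: wsp_def eigsp_def Lm_sq_T T_eq_iff flip: lin_scale[OF lin_T])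

lemma wsp_sq: "wsp (sq V) k = T ` wsp V k"
  using wsp_sq_T T_surj by (metis (no_types, lifting) image_iff subsetI subset_antisym)

text \<open>Linearity and grading are transported along the bijection \<open>T\<close>, which
  intertwines \<open>L\<^sub>0\<close> and \<open>L[0]\<close>.\<close>

lemma graded_sq: "graded_voa (sq V)"
proof (intro graded_voa.intro graded_voa_axioms.intro)
  show "vector_space (vscale (sq V))" using vector_space_axioms by simp
  have "lin (Lm (sq V) 0)"
  proof (rule linI)
    fix x y c
    obtain a b where ab: "x = T a" "y = T b" using T_surj by metis
    show "Lm (sq V) 0 (x + y) = Lm (sq V) 0 x + Lm (sq V) 0 y"
      unfolding ab by (simp only: Lm_sq_T L_add lin_add[OF lin_T, symmetric])
    show "Lm (sq V) 0 (c \<odot> x) = c \<odot> Lm (sq V) 0 x"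
      unfolding ab by (simp only: Lm_sq_T L_scale lin_scale[OF lin_T, symmetric])
  qed
  then show "Vector_Spaces.linear (vscale (sq V)) (vscale (sq V)) (Lm (sq V) 0)" by simp
  have "v \<in> span (\<Union>n. wsp (sq V) n)" for v
  proof -
    obtain w where w: "v = T w" using T_surj by metis
    have "v = T (\<Sum>k | wpart V k w \<noteq> 0. wpart V k w)"
      using Sum_any_wpart[of w] by (simp add: w Sum_any.expand_set)
    also have "\<dots> = (\<Sum>k | wpart V k w \<noteq> 0. T (wpart V k w))" by (rule lin_sum[OF lin_T])
    also have "\<dots> \<in> span (\<Union>n. wsp (sq V) n)"
      using wsp_sq_T wpart_in by (intro span_sum span_base) blast
    finally show ?thesis .
  qed
  then show "module.span (vscale (sq V)) (\<Union>n. wsp (sq V) n) = UNIV" by auto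
qed

text \<open>Apply \<open>T_L\<close> to \<open>L\<^sub>-\<^sub>2 1\<close> with
  \<open>T 1 = 1\<close>. It follows that the new conformal vector has weight 2 and is killed by
  \<open>L[1]\<close>.\<close>

lemma T_omega: "T (omega V) = omega (sq V)"
proof -
  have "sq_coeff 2 (m + 1) (-1) \<odot> L m (vac V) = 0" if "m \<noteq> -2" for m
    using that sq_coeff_eq_0[of "m + 1" "-1" 2] L_vac[of m] by (cases "m < -2") auto
  then have "Sum_any (\<lambda>m. sq_coeff 2 (m + 1) (-1) \<odot> L m (vac V)) = omega V"
    using sq_coeff_minus_1[of 2 "-2"] by (subst Sum_any_delta_eq[of "-2"]) (auto simp: omega_eq)
  then show ?thesis
    using T_L[of "-2" "vac V"] by (simp add: omega_eq T_vac sqL_def)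
qed

lemma omega_sq_wsp: "omega (sq V) \<in> wsp (sq V) 2"
  unfolding T_omega[symmetric] wsp_sq_T by (rule omega_wsp)

lemma L1_omega_sq: "Lm (sq V) 1 (omega (sq V)) = 0"
proof -
  have "L 1 (omega V) = 0"
    using virasoro[of 1 "-2" "vac V"] by (simp add: omega_eq L_vac L_zero)
  then show ?thesis unfolding T_omega[symmetric] Lm_sq_T by (simp add: lin_zero[OF lin_T])
qed

lemma Lm_sq_zero: "Lm (sq V) n 0 = 0"
  using Lm_sq_T[of n 0] by (simp add: L_zero lin_zero[OF lin_T])

text \<open>Since \<open>L[1]\<close> kills the conformal vector, only \<open>i = 0\<close>
  survives, with sign \<open>(-1)^2\<close> and mode
  \<open>4 - (n + 1) - 2 = - n + 1\<close>.\<close>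

lemma adj_omega_sq: "adj_mode (sq V) (omega (sq V)) (n + 1) b = Lm (sq V) (- n) b"
proof -
  interpret sq: graded_voa "sq V" by (rule graded_sq)
  have zero: "(Lm (sq V) 1 ^^ i) 0 = 0" for i
    by (induction i) (simp_all add: Lm_sq_zero)
  have sq_zero: "sq_mode V 0 m b = 0" for m by (rule lin_zero[OF lin_sq_mode])
  have pow: "(Lm (sq V) 1 ^^ i) (omega (sq V)) = 0" if "i \<noteq> 0" for i
    using that zero by (cases i) (simp_all add: funpow_swap1 L1_omega_sq del: sq_simps(4))
  have "adj_mode (sq V) (omega (sq V)) (n + 1) b = Sum_any (\<lambda>i. vscale (sq V) ((-1) powi 2 / fact i)
        (vmode (sq V) ((Lm (sq V) 1 ^^ i) (omega (sq V))) (2 * 2 - (n + 1) - int i - 2) b))"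
    unfolding adj_mode_def
    by (rule sq.homog_ext_homog[OF omega_sq_wsp]) (simp add: zero sq_zero)
  also have "\<dots> = Lm (sq V) (- n) b"
  proof (subst Sum_any_delta_eq[of 0])
    show "vscale (sq V) ((-1) powi 2 / fact i)
        (vmode (sq V) ((Lm (sq V) 1 ^^ i) (omega (sq V))) (2 * 2 - (n + 1) - int i - 2) b) = 0"
      if "i \<noteq> 0" for i
      unfolding pow[OF that] by (simp add: sq_zero)
  qed (simp add: Lm_def[of "sq V"] algebra_simps del: sq_simps(4))
  finally show ?thesis .
qed

section \<open>Zero modes and traces\<close>

lemma lin_zero_mode_left: "lin (\<lambda>u. zero_mode V u v)"
  unfolding zero_mode_def by (rule lin_homog_ext[OF lin_vmode_left])

text \<open>The Borcherds identity with \<open>l = 0\<close> and \<open>m = 1\<close> leaves two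
  terms, from \<open>L\<^sub>-\<^sub>1 x\<close> and \<open>L\<^sub>0 x\<close>, whose coefficients
  \<open>-k\<close> and \<open>k\<close> cancel.\<close>

lemma zero_mode_commute_L0:
  assumes x: "x \<in> wsp V k"
  shows "L 0 (vmode V x (k - 1) y) = vmode V x (k - 1) (L 0 y)"
proof -
  have g0: "((0::complex) gchoose i) = 0" if "i \<noteq> 0" for i
    using that by (cases i) auto
  have g1: "((1::complex) gchoose i) = 0" if "i \<noteq> 0" "i \<noteq> 1" for i
  proof -
    have "1 choose i = 0" using that by (simp add: binomial_eq_0)
    then show ?thesis by (metis binomial_gbinomial of_nat_0 of_nat_1)
  qed
  have "Sum_any (\<lambda>i. vscale V (of_int 1 gchoose i)
           (vmode V (vmode V (omega V) (0 + int i) x) (1 + (k - 1) - int i) y)) =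
        Sum_any (\<lambda>i. vscale V ((-1) ^ i * (of_int 0 gchoose i))
           (vmode V (omega V) (0 + 1 - int i) (vmode V x ((k - 1) + int i) y)
            - vscale V ((-1) powi 0)
                (vmode V x (0 + (k - 1) - int i) (vmode V (omega V) (1 + int i) y))))"
    by (rule borcherds[of 1 "omega V" 0 x "k - 1" y])
  also have "\<dots> = L 0 (vmode V x (k - 1) y) - vmode V x (k - 1) (L 0 y)"
    by (subst Sum_any_delta_eq[of 0]) (auto simp: g0 Lm_def)
  also have "Sum_any (\<lambda>i. vscale V (of_int 1 gchoose i)
           (vmode V (vmode V (omega V) (0 + int i) x) (1 + (k - 1) - int i) y)) =
        (\<Sum>i\<in>{0, 1}. vscale V (of_int 1 gchoose i)
           (vmode V (vmode V (omega V) (0 + int i) x) (1 + (k - 1) - int i) y))"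
    by (rule Sum_any.expand_superset) (use g1 in auto)
  also have "\<dots> = vmode V (L (-1) x) k y + vmode V (L 0 x) (k - 1) y"
    by (simp add: Lm_def)
  also have "vmode V (L (-1) x) k y = - of_int k \<odot> vmode V x (k - 1) y"
    using voa by (simp add: voa_def)
  also have "vmode V (L 0 x) (k - 1) y = of_int k \<odot> vmode V x (k - 1) y"
    by (simp add: wspD[OF x] lin_scale[OF lin_vmode_left])
  finally show ?thesis by simp
qed

lemma zero_mode_eigsp:
  assumes "v \<in> eigsp V c" shows "zero_mode V u v \<in> eigsp V c"
proof -
  have "vmode V (wpart V k u) (k - 1) v \<in> eigsp V c" for k
    using zero_mode_commute_L0[OF wpart_in, of k u v] assms
    by (simp add: eigsp_def lin_scale[OF lin_vmode])
  then show ?thesis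
    unfolding zero_mode_def homog_ext_def Sum_any.expand_set
    by (intro subspace_sum[OF subspace_eigsp]) auto
qed

lemma trace_basis: "subspace W \<Longrightarrow> is_basis_of V W (SOME B. is_basis_of V W B)"
proof (rule someI_ex)
  assume W: "subspace W"
  obtain B where "B \<subseteq> W" "independent B" "W \<subseteq> span B" using maximal_independent_subset by blast
  then have "independent B \<and> span B = W"
    using span_minimal[OF _ W] by (simp add: subset_antisym)
  then show "\<exists>B. is_basis_of V W B" unfolding is_basis_of_def by blast
qed

lemma trace_on_0: "trace_on V {0} f = 0"
proof -
  define B where "B = (SOME B. is_basis_of V {0} B)"
  have B: "independent B" "span B = {0}"
    using trace_basis[OF subspace_single_0] by (auto simp: is_basis_of_def B_def)
  have "B \<subseteq> {0}" using span_superset[of B] B(2) by simp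
  moreover have "0 \<notin> B" using B(1) dependent_zero by blast
  ultimately have "B = {}" by auto
  then show ?thesis by (simp add: trace_on_def Let_def flip: B_def)
qed

text \<open>Whatever basis \<open>SOME\<close> selects, it consists of one nonzero multiple of
  \<open>v\<close>.\<close>

lemma trace_on_line:
  assumes "v \<noteq> 0" and "lin f" and "f v = c \<odot> v"
  shows "trace_on V (span {v}) f = c"
proof -
  define B where "B = (SOME B. is_basis_of V (span {v}) B)"
  have B: "independent B" "span B = span {v}"
    using trace_basis[OF subspace_span, of "{v}"] by (auto simp: is_basis_of_def B_def)
  have "finite B" "card B \<le> 1"
    using independent_span_bound[of "{v}" B] B span_superset by auto
  moreover have "B \<noteq> {}"
  proof
    assume "B = {}"
    then have "span {v} = {0}" using B(2) by simp
    then show False using assms(1) span_base[of v "{v}"] by auto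
  qed
  ultimately have "card B = 1" by (metis One_nat_def card_0_eq le_Suc_eq le_zero_eq)
  then obtain b where b: "B = {b}" by (elim card_1_singletonE)
  then have "b \<in> span {v}" using B(2) span_base by blast
  then obtain a where "b = a \<odot> v" by (auto simp: span_singleton)
  then have "f b = c \<odot> b" using scale_left_commute by (simp only: lin_scale[OF assms(2)] assms(3))
  moreover have "representation B (c \<odot> b) b = c"
    using representation_scale[OF B(1) span_base, of b c] representation_basis[OF B(1), of b] b by simp
  ultimately show ?thesis
    unfolding trace_on_def Let_def B_def[symmetric] by (simp add: b)
qed

text \<open>The chosen basis depends on the eigenspace alone. Coordinates are additive only inside
  its span, so the invariance \<open>zero_mode_eigsp\<close> is essential.\<close>

lemma lin_Z1: "Vector_Spaces.linear (vscale V) (*) (\<lambda>u. Z1 V u s)"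
proof -
  define W where "W = eigsp V (s + ccharge V / 24)"
  define B where "B = (SOME B. is_basis_of V W B)"
  have B: "independent B" "span B = W"
    using trace_basis[of W] subspace_eigsp by (auto simp: is_basis_of_def B_def W_def)
  have in_span: "zero_mode V u b \<in> span B" if "b \<in> B" for u b
    using that zero_mode_eigsp B(2) span_base unfolding W_def by blast
  have "Z1 V u s = (\<Sum>b\<in>B. representation B (zero_mode V u b) b)" for u
    by (simp add: Z1_def trace_on_def Let_def B_def W_def)
  moreover have "vector_space ((*) :: complex \<Rightarrow> complex \<Rightarrow> complex)"
    by unfold_locales (simp_all add: algebra_simps)
  ultimately show ?thesis
    using vector_space_axioms in_span
    by (simp add: Vector_Spaces.linear_iff lin_add[OF lin_zero_mode_left] lin_scale[OF lin_zero_mode_left]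
        representation_add[OF B(1)] representation_scale[OF B(1)] sum.distrib sum_distrib_left)
qed

lemma lin_zero_mode: "lin (zero_mode V u)"
  unfolding zero_mode_def[abs_def] homog_ext_def
proof (rule lin_Sum_any_pointwise[OF lin_vmode])
  show "finite {k. vmode V (wpart V k u) (k - 1) v \<noteq> 0}" for v
    by (rule finite_subset[OF _ finite_wpart[of u]]) (auto simp: lin_zero[OF lin_vmode_left])
qed

text \<open>The creation axiom kills the positive weights and returns the weight 0 part; negative
  weights are absent.\<close>

lemma zero_mode_vac: "zero_mode V u (vac V) = wpart V 0 u"
proof -
  have "vmode V (wpart V k u) (k - 1) (vac V) = 0" if "k \<noteq> 0" for k
  proof (cases "k < 0")
    case True
    then have "wpart V k u = 0" using wpart_in[of k u] wsp_neg by auto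
    then show ?thesis by (simp add: lin_zero[OF lin_vmode_left])
  qed (use that creation(2) in auto)
  then show ?thesis
    unfolding zero_mode_def homog_ext_def
    by (subst Sum_any_delta_eq[of 0]) (auto simp: creation)
qed

section \<open>The weight components of the exponential applied to the vacuum\<close>

definition Tdag_step :: "(int \<Rightarrow> 'a) \<Rightarrow> int \<Rightarrow> 'a" where
  "Tdag_step y m = Sum_any (\<lambda>i. of_rat (alpha i) \<odot> L (- int i) (y (m - int i)))"

abbreviation lam_step :: "nat \<Rightarrow> int \<Rightarrow> 'a" where
  "lam_step k \<equiv> (Tdag_step ^^ k) (\<lambda>n. wpart V n (vac V))"

lemma lam_eq: "lam V n = Sum_any (\<lambda>k. (1 / fact k) \<odot> lam_step k n)"
  by (simp add: lam_def Tdag_op_def Tdag_step_def[abs_def])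

lemma lam_step_wsp: "lam_step k m \<in> wsp V m"
proof (induction k arbitrary: m)
  case (Suc k)
  have "of_rat (alpha i) \<odot> L (- int i) (lam_step k (m - int i)) \<in> wsp V m" for i
    using L_wsp[OF Suc, of "- int i" "m - int i"] by (simp add: subspace_scale[OF subspace_wsp])
  then show ?case
    unfolding funpow.simps comp_def Tdag_step_def Sum_any.expand_set
    by (intro subspace_sum[OF subspace_wsp]) auto
qed (simp add: wpart_in)

text \<open>Because \<open>alpha 0 = 0\<close>, each step raises the weight by at least one,
  starting from the vacuum in weight 0.\<close>

lemma lam_step_eq_0: "m < int k \<Longrightarrow> lam_step k m = 0"
proof (induction k arbitrary: m)
  case 0
  then show ?case by (simp add: wpart_homog[OF vac_wsp])
next
  case (Suc k)
  have "of_rat (alpha i) \<odot> L (- int i) (lam_step k (m - int i)) = 0" for i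
    using Suc.prems Suc.IH[of "m - int i"] by (cases "i = 0") (simp_all add: alpha(1) L_zero)
  then show ?case
    unfolding funpow.simps comp_def Tdag_step_def by (simp only: Sum_any.neutral)
qed

lemma finite_lam_support: "finite {k. (1 / fact k) \<odot> lam_step k n \<noteq> 0}"
proof (rule finite_subset[OF _ finite_atMost[of "nat n"]])
  show "{k. (1 / fact k) \<odot> lam_step k n \<noteq> 0} \<subseteq> {..nat n}"
  proof
    fix k assume "k \<in> {k. (1 / fact k) \<odot> lam_step k n \<noteq> 0}"
    then have "\<not> n < int k" using lam_step_eq_0[of n k] by auto
    then show "k \<in> {..nat n}" by simp
  qed
qed

lemma lam_wsp: "lam V n \<in> wsp V n"
  unfolding lam_eq Sum_any.expand_set
  by (intro subspace_sum[OF subspace_wsp] subspace_scale[OF subspace_wsp] lam_step_wsp)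

lemma lam_tilde_wsp: "lam_tilde V n \<in> wsp (sq V) (int n)"
  unfolding lam_tilde_def wsp_sq_T by (rule lam_wsp)

end

section \<open>The invariant form and the limit\<close>

locale cft_voa_form = cft_voa V for V :: "'a::ab_group_add voa" +
  fixes F :: "'a \<Rightarrow> 'a \<Rightarrow> complex"
  assumes form: "normalized_invariant_form (sq V) F"
begin

lemma lin_F: "Vector_Spaces.linear (vscale V) (*) (F a)"
  and lin_F_left: "Vector_Spaces.linear (vscale V) (*) (\<lambda>a. F a b)"
  and F_sym: "F a b = F b a"
  and F_vac: "F (vac V) (vac V) = 1"
  and F_nondeg: "(\<And>b. F a b = 0) \<Longrightarrow> a = 0"
  using form by (simp_all add: normalized_invariant_form_def)

lemma F_invariant: "F (vmode (sq V) u n a) b = F a (adj_mode (sq V) u n b)"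
  using form unfolding normalized_invariant_form_def by blast

lemma F_L: "F (Lm (sq V) n a) b = F a (Lm (sq V) (- n) b)"
  using F_invariant[of "omega (sq V)" "n + 1" a b] unfolding adj_omega_sq by (simp add: Lm_def)

lemma F_T_L: "F (T (L n a)) (T b) = F (T a) (T (L (- n) b))"
  using F_L[of n "T a" "T b"] by (simp only: Lm_sq_T)

lemma F_scale: "F a (c \<odot> b) = c * F a b" "F (c \<odot> a) b = c * F a b"
  and F_zero: "F a 0 = 0" "F 0 b = 0"
proof -
  show s: "F a (c \<odot> b) = c * F a b" "F (c \<odot> a) b = c * F a b" for a b c
    using lin_F lin_F_left by (simp_all add: Vector_Spaces.linear_iff)
  show "F a 0 = 0" "F 0 b = 0" using s(1)[of a 0 0] s(2)[of 0 0 b] by simp_all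
qed

lemma F_sum_left: "F (sum f S) b = (\<Sum>x\<in>S. F (f x) b)"
proof -
  interpret Vector_Spaces.linear "vscale V" "(*)" "\<lambda>a. F a b" by (rule lin_F_left)
  show ?thesis by (rule sum)
qed

lemma F_orthogonal:
  assumes "a \<in> wsp (sq V) j" and "b \<in> wsp (sq V) k" and "j \<noteq> k"
  shows "F a b = 0"
  using F_L[of 0 a b] assms by (simp add: wsp_def eigsp_def F_scale)

text \<open>\<open>T\<close> maps weight \<open>k\<close> to square bracket weight \<open>k\<close>,
  which is orthogonal to the vacuum unless \<open>k = 0\<close>; in weight 0 there are only
  multiples of the vacuum.\<close>

lemma wpart_0: "wpart V 0 x = F (vac V) (T x) \<odot> vac V"
proof (rule lin_eqI[OF lin_wpart, of "\<lambda>x. F (vac V) (T x) \<odot> vac V"])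
  show "lin (\<lambda>x. F (vac V) (T x) \<odot> vac V)"
    using lin_F by (intro linI) (simp_all add: Vector_Spaces.linear_iff lin_add[OF lin_T] lin_scale[OF lin_T] scale_left_distrib)
next
  fix k v assume v: "v \<in> wsp V k"
  show "wpart V 0 v = F (vac V) (T v) \<odot> vac V"
  proof (cases "k = 0")
    case True
    then obtain c where "v = c \<odot> vac V" using v cft by (auto simp: cft_type_def span_singleton)
    then show ?thesis using v True by (simp add: wpart_homog lin_scale[OF lin_T] T_vac F_scale F_vac)
  next
    case False
    have "vac V \<in> wsp (sq V) 0" using vac_wsp wsp_sq_T T_vac by metis
    then have "F (vac V) (T v) = 0" using F_orthogonal False v by (simp add: wsp_sq_T)
    then show ?thesis using False by (simp add: wpart_homog[OF v])
  qed
qed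

text \<open>This exponent selects the line \<open>V\<^sub>0\<close>, on which the zero mode acts by
  the vacuum coefficient of \<open>x\<close>.\<close>

lemma Z1_low: "Z1 V x (- (ccharge V / 24)) = F (vac V) (T x)"
proof -
  have "vac V \<noteq> 0" using F_vac F_zero by auto
  then have "trace_on V (span {vac V}) (zero_mode V x) = F (vac V) (T x)"
    by (rule trace_on_line[OF _ lin_zero_mode]) (simp add: zero_mode_vac wpart_0)
  then show ?thesis using cft by (simp add: Z1_def cft_type_def wsp_def)
qed

text \<open>One step at a time, \<open>L\<^sub>-\<^sub>i\<close> is moved to the other side as
  \<open>L\<^sub>i\<close>. Both sides then sit in weight \<open>m - i\<close>, so the induction
  hypothesis applies.\<close>

lemma F_lam_step: "w \<in> wsp V m \<Longrightarrow> F (T (lam_step k m)) (T w) = F (vac V) (T ((A ^^ k) w))"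
proof (induction k arbitrary: m w)
  case 0
  show ?case
  proof (cases "m = 0")
    case True
    then show ?thesis by (simp add: wpart_homog[OF vac_wsp] T_vac)
  next
    case False
    have "vac V \<in> wsp (sq V) 0" using vac_wsp wsp_sq_T T_vac by metis
    then have "F (vac V) (T w) = 0" using F_orthogonal False 0 by (simp add: wsp_sq_T)
    then show ?thesis using False by (simp add: wpart_homog[OF vac_wsp] lin_zero[OF lin_T] F_zero)
  qed
next
  case (Suc k)
  have G1: "Vector_Spaces.linear (vscale V) (*) (\<lambda>a. F (T a) (T w))"
    using lin_F_left by (simp add: Vector_Spaces.linear_iff lin_add[OF lin_T] lin_scale[OF lin_T])
  have G2: "Vector_Spaces.linear (vscale V) (*) (\<lambda>x. F (vac V) (T ((A ^^ k) x)))"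
    using lin_F by (simp add: Vector_Spaces.linear_iff lin_add[OF lin_T] lin_scale[OF lin_T]
        lin_add[OF lin_A_power] lin_scale[OF lin_A_power])
  have "{i. of_rat (alpha i) \<odot> L (- int i) (lam_step k (m - int i)) \<noteq> 0} \<subseteq> {..nat m}"
  proof
    fix i assume "i \<in> {i. of_rat (alpha i) \<odot> L (- int i) (lam_step k (m - int i)) \<noteq> 0}"
    then have "\<not> m - int i < int k" using lam_step_eq_0[of "m - int i" k] L_zero by auto
    then show "i \<in> {..nat m}" by simp
  qed
  then have fin1: "finite {i. of_rat (alpha i) \<odot> L (- int i) (lam_step k (m - int i)) \<noteq> 0}"
    by (rule finite_subset) simp
  have "{i. of_rat (alpha i) \<odot> L (int i) w \<noteq> 0} \<subseteq> {..nat m}"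
  proof
    fix i assume "i \<in> {i. of_rat (alpha i) \<odot> L (int i) w \<noteq> 0}"
    then have "\<not> m + 1 \<le> int i" using below_L_eq_0[OF below_wsp[OF Suc.prems], of "int i"] by auto
    then show "i \<in> {..nat m}" by simp
  qed
  then have fin2: "finite {i. of_rat (alpha i) \<odot> L (int i) w \<noteq> 0}"
    by (rule finite_subset) simp
  have "F (T (lam_step (Suc k) m)) (T w) =
      Sum_any (\<lambda>i. F (T (of_rat (alpha i) \<odot> L (- int i) (lam_step k (m - int i)))) (T w))"
    unfolding funpow.simps comp_def Tdag_step_def[of _ m] by (rule linear_Sum_any[OF G1 fin1])
  also have "\<dots> = Sum_any (\<lambda>i. F (vac V) (T ((A ^^ k) (of_rat (alpha i) \<odot> L (int i) w))))"
  proof (rule Sum_any.cong)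
    fix i
    show "F (T (of_rat (alpha i) \<odot> L (- int i) (lam_step k (m - int i)))) (T w) =
        F (vac V) (T ((A ^^ k) (of_rat (alpha i) \<odot> L (int i) w)))"
      using Suc.IH[OF L_wsp[OF Suc.prems], of "int i"]
      by (simp add: lin_scale[OF lin_T] lin_scale[OF lin_A_power] F_scale F_T_L)
  qed
  also have "\<dots> = F (vac V) (T ((A ^^ k) (A w)))"
    using linear_Sum_any[OF G2 fin2] by (simp only: A_eq)
  finally show ?case by (simp add: funpow_swap1)
qed

text \<open>Summed with the exponential weights, the powers of \<open>A\<close> in
  \<open>F_lam_step\<close> assemble to a second \<open>T\<close>, and \<open>Z1_low\<close>
  interprets the result.\<close>

lemma F_lam_tilde:
  assumes "u \<in> wsp (sq V) (int n)"
  shows "F (lam_tilde V n) u = Z1 V u (- (ccharge V / 24))"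
proof -
  obtain w where w: "u = T w" "w \<in> wsp V (int n)" using assms by (auto simp: wsp_sq)
  have G1: "Vector_Spaces.linear (vscale V) (*) (\<lambda>a. F (T a) (T w))"
    using lin_F_left by (simp add: Vector_Spaces.linear_iff lin_add[OF lin_T] lin_scale[OF lin_T])
  have G2: "Vector_Spaces.linear (vscale V) (*) (\<lambda>x. F (vac V) (T x))"
    using lin_F by (simp add: Vector_Spaces.linear_iff lin_add[OF lin_T] lin_scale[OF lin_T])
  have "F (lam_tilde V n) u = Sum_any (\<lambda>k. F (T ((1 / fact k) \<odot> lam_step k (int n))) (T w))"
    unfolding lam_tilde_def lam_eq w(1) by (rule linear_Sum_any[OF G1 finite_lam_support])
  also have "\<dots> = Sum_any (\<lambda>k. F (vac V) (T ((1 / fact k) \<odot> (A ^^ k) w)))"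
    by (simp add: lin_scale[OF lin_T] F_scale F_lam_step[OF w(2)])
  also have "\<dots> = F (vac V) (T (T w))"
    unfolding T_eq[of w] by (rule linear_Sum_any[OF G2 finite_T_support, symmetric])
  finally show ?thesis by (simp add: Z1_low w(1))
qed

text \<open>Distinct weights are orthogonal, so the form stays nondegenerate on each weight space,
  and dual bases exist there.\<close>

lemma basis_expansion:
  assumes B: "is_basis_of V (wsp (sq V) k) B" and x: "x \<in> wsp (sq V) k"
  shows "finite B" and "\<And>u. u \<in> B \<Longrightarrow> dual_vec F (wsp (sq V) k) B u \<in> wsp (sq V) k"
    and "(\<Sum>u\<in>B. F x (dual_vec F (wsp (sq V) k) B u) \<odot> u) = x"
proof -
  have B: "independent B" "span B = wsp (sq V) k" using B by (auto simp: is_basis_of_def)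
  obtain S where S: "finite S" "wsp V k \<subseteq> span S"
  proof -
    have "\<exists>S. finite S \<and> wsp V k \<subseteq> span S" using voa by (simp add: voa_def)
    then show ?thesis using that by blast
  qed
  interpret lT: Vector_Spaces.linear "vscale V" "vscale V" T by (rule lin_T)
  have "B \<subseteq> span (T ` S)"
    using B(2) span_superset[of B] S(2) unfolding wsp_sq lT.span_image by blast
  then show fin: "finite B" using independent_span_bound[of "T ` S" B] S(1) B(1) by simp
  have nondeg: "w = 0" if w: "w \<in> span B" and 0: "\<And>b. b \<in> B \<Longrightarrow> F b w = 0" for w
  proof (rule F_nondeg)
    fix y
    interpret sq: graded_voa "sq V" by (rule graded_sq)
    interpret l: Vector_Spaces.linear "vscale V" "(*)" "\<lambda>a. F a w" by (rule lin_F_left)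
    have homog: "F a w = 0" if "a \<in> wsp (sq V) j" for a j
    proof (cases "j = k")
      case True
      then have "a \<in> span B" using that B(2) by simp
      then show ?thesis by (rule l.eq_0_on_span[rotated]) (rule 0)
    next
      case False
      then show ?thesis using F_orthogonal that w B(2) by blast
    qed
    have "y \<in> span (\<Union>n. wsp (sq V) n)" using sq.grading by simp
    then have "F y w = 0" by (rule l.eq_0_on_span[rotated]) (use homog in blast)
    then show "F w y = 0" by (simp add: F_sym)
  qed
  have dual: "dual_vec F (wsp (sq V) k) B u \<in> span B \<and>
      (\<forall>b\<in>B. F b (dual_vec F (wsp (sq V) k) B u) = (if b = u then 1 else 0))" if "u \<in> B" for u
    unfolding dual_vec_def B(2)[symmetric]
    by (rule theI') (rule dual_basis_ex1[OF fin B(1) lin_F nondeg that])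
  then show "\<And>u. u \<in> B \<Longrightarrow> dual_vec F (wsp (sq V) k) B u \<in> wsp (sq V) k" using B(2) by blast
  obtain c where c: "x = (\<Sum>b\<in>B. c b \<odot> b)"
    using x unfolding B(2)[symmetric] span_finite[OF fin] by auto
  have "F x (dual_vec F (wsp (sq V) k) B u) = c u" if u: "u \<in> B" for u
  proof -
    have "F x (dual_vec F (wsp (sq V) k) B u) = (\<Sum>b\<in>B. c b * (if b = u then 1 else 0))"
      unfolding c F_sum_left using dual[OF u] by (intro sum.cong refl) (simp add: F_scale)
    also have "\<dots> = c u" using u fin by (simp add: if_distrib cong: if_cong)
    finally show ?thesis .
  qed
  then show "(\<Sum>u\<in>B. F x (dual_vec F (wsp (sq V) k) B u) \<odot> u) = x"
    unfolding c by (intro sum.cong refl) simp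
qed

lemma has_q2_limit_Z2:
  assumes B: "\<And>n. is_basis_of V (wsp (sq V) (int n)) (B n)"
  shows "has_q2_limit (q2_power_times (ccharge V / 24) (Z2 V F B)) (Abs_fps (\<lambda>n. Z1 V (lam_tilde V n)))"
  unfolding has_q2_limit_def
proof (intro allI conjI impI)
  fix n s1 s2
  let ?d = "dual_vec F (wsp (sq V) (int n)) (B n)"
  show "s2 \<in> \<nat>" if "fps_nth (q2_power_times (ccharge V / 24) (Z2 V F B)) n s1 s2 \<noteq> 0"
  proof (rule ccontr)
    assume "s2 \<notin> \<nat>"
    \<comment> \<open>The shift by \<open>C/24\<close> cancels the one in \<open>Z1\<close>, so
      \<open>s2\<close> is an eigenvalue of \<open>L\<^sub>0\<close>, and its eigenspace is
      trivial.\<close>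
    then have "Z1 V u (s2 - ccharge V / 24) = 0" for u
      by (simp add: Z1_def eigsp_trivial trace_on_0)
    then show False using that by (simp add: q2_power_times_def Z2_def)
  qed
  interpret l: Vector_Spaces.linear "vscale V" "(*)" "\<lambda>u. Z1 V u s1" by (rule lin_Z1)
  note exp = basis_expansion[OF B lam_tilde_wsp]
  have "fps_nth (q2_power_times (ccharge V / 24) (Z2 V F B)) n s1 0 =
      (\<Sum>u\<in>B n. Z1 V u s1 * Z1 V (?d u) (- (ccharge V / 24)))"
    by (simp add: q2_power_times_def Z2_def)
  \<comment> \<open>The second factor is the coefficient of \<open>u\<close> in
    \<open>lam_tilde V n\<close>; linearity of \<open>Z1\<close> then sums the expansion.\<close>
  also have "\<dots> = (\<Sum>u\<in>B n. Z1 V (F (lam_tilde V n) (?d u) \<odot> u) s1)"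
    by (intro sum.cong refl) (simp add: l.scale F_lam_tilde[OF exp(2)])
  also have "\<dots> = Z1 V (lam_tilde V n) s1"
    unfolding l.sum[symmetric] exp(3) ..
  finally show "fps_nth (q2_power_times (ccharge V / 24) (Z2 V F B)) n s1 0 =
      fps_nth (Abs_fps (\<lambda>n. Z1 V (lam_tilde V n))) n s1" by simp
qed

end

theorem lemma3p8:
  fixes V :: "'a::ab_group_add voa"
    and F :: "'a \<Rightarrow> 'a \<Rightarrow> complex"
    and B :: "nat \<Rightarrow> 'a set"
  assumes "voa V" and "simple_voa V" and "self_dual V" and "cft_type V"
    and "normalized_invariant_form (sq V) F"
    and "\<And>n. is_basis_of V (wsp (sq V) (int n)) (B n)"
  shows "(\<forall>n. lam_tilde V n \<in> wsp (sq V) (int n)) \<and>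
    has_q2_limit (q2_power_times (ccharge V / 24) (Z2 V F B))
      (Abs_fps (\<lambda>n. Z1 V (lam_tilde V n)))"
proof -
  interpret cft_voa_form V F
    using assms by (intro cft_voa_form.intro cft_voa.intro cft_voa_form_axioms.intro)
  show ?thesis using lam_tilde_wsp has_q2_limit_Z2[of B, OF assms(6)] by blast
qed

end
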